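(* Let $n\ge 1$ and let $\delta(n)=1$ if $n\in\{1,3\}$, $\delta(n)=0$ otherwise. If $P$ is any set of $n$ points in convex position in the plane and $\mathcal{K}$ is a family of convex sets that encapsulates $P$, then $|\mathcal{K}|\ge \lfloor\frac{n+5}{2}\rfloor-\delta(n)$. In particular $enc^c(n)\ge \lfloor\frac{n+5}{2}\rfloor-\delta(n)$.
   Context: A set of points is in convex position if no point lies in the convex hull of the others. A point $p\in\mathbb{R}^2$ is encapsulated by sets $K_1,\dots,K_m$ if there is a neighborhood $N$ of $p$ with $(\bigcup_i K_i)\cap N=N\setminus\{p\}$; a family encapsulates $P$ if it encapsulates every point of $P$. $enc^c(n)$ is the maximum, over all $n$-point sets $P$ in convex position in the plane, of the smallest number of convex sets that encapsulate $P$. *)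

theory Defs
  imports "HOL-Analysis.Analysis"
begin

definition convex_position :: "(real^2) set \<Rightarrow> bool" where
  "convex_position P \<longleftrightarrow> (\<forall>p\<in>P. p \<notin> convex hull (P - {p}))"

definition encapsulates_point :: "(real^2) set set \<Rightarrow> real^2 \<Rightarrow> bool" where
  "encapsulates_point \<K> p \<longleftrightarrow> (\<exists>N. p \<in> interior N \<and> \<Union>\<K> \<inter> N = N - {p})"

definition encapsulates :: "(real^2) set set \<Rightarrow> (real^2) set \<Rightarrow> bool" where
  "encapsulates \<K> P \<longleftrightarrow> (\<forall>p\<in>P. encapsulates_point \<K> p)"

definition convex_enc_number :: "(real^2) set \<Rightarrow> nat" where
  "convex_enc_number P =
     (LEAST m. \<exists>\<K>. finite \<K> \<and> card \<K> = m \<and> (\<forall>C\<in>\<K>. convex C) \<and> encapsulates \<K> P)"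

text \<open>For \<open>n \<ge> 1\<close> the set of values below is finite and nonempty, and each
  value is attained by some finite family of convex sets, so neither \<open>Max\<close> nor \<open>LEAST\<close>
  is applied outside its intended domain; see the lemmas at the end of this theory.\<close>

definition enc_convex :: "nat \<Rightarrow> nat" where
  "enc_convex n = Max {convex_enc_number P | P. card P = n \<and> convex_position P}"

definition \<delta> :: "nat \<Rightarrow> nat" where
  "\<delta> n = (if n \<in> {1, 3} then 1 else 0)"

lemma ex_convex_encapsulating_family:
  assumes "finite P"
  shows "\<exists>\<K>. finite \<K> \<and> card \<K> \<le> 9 ^ card P \<and> (\<forall>C\<in>\<K>. convex C) \<and> encapsulates \<K> P"
proof -
  define F where "F z = restrict (\<lambda>p. (sgn (z$1 - p$1), sgn (z$2 - p$2))) P" for z :: "real^2"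
  define \<K> where "\<K> = (\<lambda>h. F -` {h}) ` (F ` (- P))"
  define S where "S = {-1, 0, 1 :: real} \<times> {-1, 0, 1 :: real}"
  have sub: "F ` (- P) \<subseteq> PiE P (\<lambda>_. S)"
  proof
    fix g assume "g \<in> F ` (- P)"
    then obtain z where g: "g = F z" by blast
    have "sgn t \<in> {-1, 0, 1 :: real}" for t :: real by (simp add: sgn_if)
    then show "g \<in> PiE P (\<lambda>_. S)"
      unfolding g F_def S_def by (intro restrict_PiE_iff[THEN iffD2] ballI SigmaI)
  qed
  have cardS: "card S = 9" and finS: "finite S"
    by (simp_all add: S_def card_cartesian_product)
  have finPi: "finite (PiE P (\<lambda>_. S))"
    using assms finS by (simp add: finite_PiE)
  have fin: "finite (F ` (- P))"
    using sub finPi by (rule finite_subset)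
  have finK: "finite \<K>"
    unfolding \<K>_def using fin by (rule finite_imageI)
  have "card \<K> \<le> card (F ` (- P))"
    unfolding \<K>_def using fin by (rule card_image_le)
  also have "\<dots> \<le> card (PiE P (\<lambda>_. S))"
    using sub finPi by (rule card_mono[rotated])
  also have "\<dots> = 9 ^ card P"
    using assms by (simp add: card_PiE cardS)
  finally have card: "card \<K> \<le> 9 ^ card P" .
  have cvx1: "convex {z :: real^2. sgn (z$i - a) = s}" for i a s
  proof -
    have lin: "{z :: real^2. sgn (z$i - a) = s} = (\<lambda>z. z$i) -` {t. sgn (t - a) = s}"
      by auto
    consider "s = 1" | "s = 0" | "s = -1" | "s \<notin> {-1, 0, 1}" by blast
    then have "convex {t. sgn (t - a) = s}"
    proof cases
      case 1
      then have "{t. sgn (t - a) = s} = {a<..}" by (auto simp: sgn_1_pos)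
      then show ?thesis by simp
    next
      case 2
      then have "{t. sgn (t - a) = s} = {a}" by (auto simp: sgn_zero_iff)
      then show ?thesis by simp
    next
      case 3
      then have "{t. sgn (t - a) = s} = {..<a}" by (auto simp: sgn_1_neg)
      then show ?thesis by simp
    next
      case 4
      then have "{t. sgn (t - a) = s} = {}" by (auto simp: sgn_if)
      then show ?thesis by simp
    qed
    then show ?thesis
      unfolding lin by (intro convex_linear_vimage bounded_linear.linear bounded_linear_vec_nth)
  qed
  have cvx: "convex C" if "C \<in> \<K>" for C
  proof -
    from that obtain w where C: "C = F -` {F w}"
      by (auto simp: \<K>_def)
    have "C = (\<Inter>p\<in>P. {z. sgn (z$1 - p$1) = sgn (w$1 - p$1)} \<inter> {z. sgn (z$2 - p$2) = sgn (w$2 - p$2)})"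
    proof (rule set_eqI)
      fix z
      have "z \<in> C \<longleftrightarrow> (\<forall>p\<in>P. F z p = F w p)"
        unfolding C vimage_singleton_eq
        by (metis (no_types) F_def restrict_ext restrict_apply')
      then show "z \<in> C \<longleftrightarrow> z \<in> (\<Inter>p\<in>P. {z. sgn (z$1 - p$1) = sgn (w$1 - p$1)} \<inter> {z. sgn (z$2 - p$2) = sgn (w$2 - p$2)})"
        by (simp add: F_def)
    qed
    then show ?thesis
      using cvx1 by (simp add: convex_INT convex_Int)
  qed
  have inj: "z = p" if "F z = F p" "p \<in> P" for z p
  proof -
    have "F z p = F p p" using that by simp
    then show ?thesis using that(2)
      by (simp add: F_def vec_eq_iff forall_2 sgn_zero_iff)
  qed
  have un: "\<Union>\<K> = - P"
  proof (intro equalityI subsetI)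
    fix z assume "z \<in> \<Union>\<K>"
    then obtain w where "w \<notin> P" "F z = F w" by (auto simp: \<K>_def)
    then show "z \<in> - P" using inj[of w z] by auto
  next
    fix z assume "z \<in> - P"
    then show "z \<in> \<Union>\<K>" unfolding \<K>_def by blast
  qed
  have "encapsulates_point \<K> p" if "p \<in> P" for p
    unfolding encapsulates_point_def
  proof (intro exI conjI)
    have "open (- (P - {p}))"
      using assms by (intro open_Compl finite_imp_closed) simp
    then show "p \<in> interior (- (P - {p}))"
      by (simp add: interior_open)
    show "\<Union>\<K> \<inter> - (P - {p}) = - (P - {p}) - {p}"
      using that by (auto simp: un)
  qed
  then show ?thesis
    using finK card cvx encapsulates_def by blast
qed

lemma convex_enc_number_attained:
  assumes "finite P"
  shows "\<exists>\<K>. finite \<K> \<and> card \<K> = convex_enc_number P \<and> (\<forall>C\<in>\<K>. convex C) \<and> encapsulates \<K> P"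
  unfolding convex_enc_number_def
  by (rule LeastI_ex) (use ex_convex_encapsulating_family[OF assms] in blast)

lemma ex_convex_position: "\<exists>P. finite P \<and> card P = n \<and> convex_position P"
proof -
  define f :: "nat \<Rightarrow> real^2" where "f k = vector [real k, (real k)\<^sup>2]" for k
  have f: "f k $ 1 = real k" "f k $ 2 = (real k)\<^sup>2" for k
    by (simp_all add: f_def)
  have inj: "inj f"
    by (rule injI) (metis f(1) of_nat_eq_iff)
  have "f k \<notin> convex hull (f ` {..<n} - {f k})" for k
  proof -
    define H where "H = {z :: real^2. vector [- 2 * real k, 1] \<bullet> z > - (real k)\<^sup>2}"
    have H: "z \<in> H \<longleftrightarrow> z$2 - 2 * real k * z$1 + (real k)\<^sup>2 > 0" for z
      by (simp add: H_def inner_vec_def sum_2) argo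
    have "f j \<in> H" if "j \<noteq> k" for j
    proof -
      have "(real j - real k)\<^sup>2 > 0" using that by simp
      then show ?thesis by (simp add: H f power2_eq_square algebra_simps)
    qed
    moreover have "convex H"
      unfolding H_def by (rule convex_halfspace_gt)
    moreover have "f ` {..<n} - {f k} \<subseteq> H"
      using calculation(1) by fast
    ultimately have "convex hull (f ` {..<n} - {f k}) \<subseteq> H"
      by (simp add: hull_minimal)
    moreover have "f k \<notin> H"
      by (simp add: H f power2_eq_square)
    ultimately show ?thesis by blast
  qed
  then have "convex_position (f ` {..<n})"
    by (auto simp: convex_position_def)
  moreover have "card (f ` {..<n}) = n"
    using inj by (simp add: card_image inj_on_subset)
  ultimately show ?thesis by blast
qed

lemma enc_convex_Max_wf:
  assumes "n \<ge> 1"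
  shows "finite {convex_enc_number P | P. card P = n \<and> convex_position P}"
    and "{convex_enc_number P | P. card P = n \<and> convex_position P} \<noteq> {}"
proof -
  have "convex_enc_number P \<le> 9 ^ n" if "card P = n" for P
  proof -
    have "finite P" using that assms by (intro card_ge_0_finite) simp
    from ex_convex_encapsulating_family[OF this]
    obtain \<K> where \<K>: "finite \<K>" "card \<K> \<le> 9 ^ n" "\<forall>C\<in>\<K>. convex C" "encapsulates \<K> P"
      unfolding \<open>card P = n\<close> by blast
    have "convex_enc_number P \<le> card \<K>"
      unfolding convex_enc_number_def by (rule Least_le) (use \<K> in blast)
    with \<K>(2) show ?thesis by linarith
  qed
  then show "finite {convex_enc_number P | P. card P = n \<and> convex_position P}"
    by (intro finite_subset[OF _ finite_atMost[of "9 ^ n"]]) auto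
  show "{convex_enc_number P | P. card P = n \<and> convex_position P} \<noteq> {}"
    using ex_convex_position[of n] by blast
qed

end

theory Submission
  imports Defs
begin

text \<open>If two sets of the family meet at a point \<open>c\<close> of the convex hull of \<open>P\<close>, push all points of
  \<open>P\<close> slightly away from \<open>c\<close>: every set contains at most two pushed points and the two sets through
  \<open>c\<close> contain none, so there are at least \<open>\<lceil>n/2\<rceil> + 2\<close> sets. Otherwise the sets are pairwise disjoint inside the
  hull, and then some set has at most two points of \<open>P\<close> in its closure. Deleting it together with
  two points reduces \<open>n\<close> by 2; the induction starts at \<open>n = 2\<close> and, because \<open>n = 3\<close> is
  exceptional, at \<open>n = 5\<close>.\<close>

text \<open>Since ceil(n/2) + 2 = floor((n+5)/2), a common point in the hull gives the full bound at
  once, and \<delta> can only come from sets that are disjoint there. Such sets need be neither open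
  nor closed and may still be adjacent to the same points of \<open>P\<close>, so adjacency is
  measured by closures. Convexity then turns the question into one about plane drawings: without
  meeting in the hull, two sets can neither be adjacent to the same triangle nor to one diagonal
  each of a convex quadrilateral. Losing one set with every two points matches the slope 1/2 of the
  bound, but a step from five points would land on n = 3, where \<delta> costs one set; this gap
  forces a separate analysis of five points.\<close>

section \<open>Orientation, triangles and crossing segments\<close>

text \<open>Twice the signed area of the triangle \<open>a b c\<close>, positive for a
  counterclockwise turn.\<close>

definition orient :: "real^2 \<Rightarrow> real^2 \<Rightarrow> real^2 \<Rightarrow> real" where
  "orient a b c = (b$1 - a$1) * (c$2 - a$2) - (b$2 - a$2) * (c$1 - a$1)"

lemma orient_rotate: "orient b c a = orient a b c"
  and orient_swap: "orient b a c = - orient a b c"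
  and orient_swap_right: "orient a c b = - orient a b c"
  and orient_degenerate [simp]: "orient a a c = 0" "orient a b a = 0" "orient a b b = 0"
  by (simp_all add: orient_def algebra_simps)

lemma orient_combination:
  assumes "s + t = 1"
  shows "orient a b (s *\<^sub>R x + t *\<^sub>R y) = s * orient a b x + t * orient a b y"
proof -
  have s: "s = 1 - t" using assms by simp
  show ?thesis unfolding s by (simp add: orient_def algebra_simps)
qed

lemma orient_eq_0_collinear:
  assumes "orient a b c = 0"
  shows "collinear {a, b, c}"
proof (cases "a = b")
  case False
  \<comment> \<open>The coefficient of the orthogonal projection of \<open>c - a\<close> onto
    \<open>b - a\<close>; collinearity makes \<open>c - a\<close> equal to its projection.\<close>
  define t where "t = ((c - a) \<bullet> (b - a)) / ((b - a) \<bullet> (b - a))"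
  have nz: "(b - a) \<bullet> (b - a) \<noteq> 0" using False by simp
  have nz2: "(b$1 - a$1)^2 + (b$2 - a$2)^2 \<noteq> 0"
    using nz by (simp add: inner_vec_def sum_2 power2_eq_square)
  have o: "(b$1 - a$1) * (c$2 - a$2) = (b$2 - a$2) * (c$1 - a$1)"
    using assms by (simp add: orient_def)
  have t: "t = ((c$1 - a$1) * (b$1 - a$1) + (c$2 - a$2) * (b$2 - a$2)) / ((b$1 - a$1)^2 + (b$2 - a$2)^2)"
    by (simp add: t_def inner_vec_def sum_2 power2_eq_square)
  have key: "x = (x * u + y * v) / (u^2 + v^2) * u" "y = (x * u + y * v) / (u^2 + v^2) * v"
    if "u * y = v * x" "u^2 + v^2 \<noteq> 0" for x y u v :: real
  proof -
    have "x * (u^2 + v^2) = (x * u + y * v) * u" "y * (u^2 + v^2) = (x * u + y * v) * v"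
      using that(1) by algebra+
    then show "x = (x * u + y * v) / (u^2 + v^2) * u" "y = (x * u + y * v) / (u^2 + v^2) * v"
      using that(2) by (simp_all add: eq_divide_eq)
  qed
  have "c$1 - a$1 = t * (b$1 - a$1)" "c$2 - a$2 = t * (b$2 - a$2)"
    unfolding t using key[OF o nz2] by simp_all
  then have "c - a = t *\<^sub>R (b - a)"
    by (simp add: vec_eq_iff forall_2)
  then have "c = a + t *\<^sub>R (b - a)" by (simp add: algebra_simps)
  then have "collinear {a, b, c}"
    unfolding collinear_def
    by (intro exI[of _ "b - a"]) (auto intro: exI[of _ 0] exI[of _ 1] exI[of _ "-1"] exI[of _ t] exI[of _ "-t"] exI[of _ "t - 1"] exI[of _ "1 - t"] simp: algebra_simps)
  then show ?thesis .
qed simp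

text \<open>The signed areas of the three triangles that \<open>p\<close> spans with the sides,
  divided by the whole area, are the barycentric coordinates of \<open>p\<close>.\<close>

lemma mem_triangle:
  assumes "orient a b c > 0" "orient a b p \<ge> 0" "orient b c p \<ge> 0" "orient c a p \<ge> 0"
  shows "p \<in> convex hull {a, b, c}"
proof -
  define D where "D = orient a b c"
  have D: "D > 0" using assms by (simp add: D_def)
  have s: "orient b c p + orient c a p + orient a b p = D"
    by (simp add: D_def orient_def algebra_simps)
  have v: "D *\<^sub>R p = orient b c p *\<^sub>R a + orient c a p *\<^sub>R b + orient a b p *\<^sub>R c"
    by (simp add: D_def orient_def vec_eq_iff forall_2 algebra_simps)
  have "p = (1 / D) *\<^sub>R (D *\<^sub>R p)" using D by simp
  also have "\<dots> = (orient b c p / D) *\<^sub>R a + (orient c a p / D) *\<^sub>R b + (orient a b p / D) *\<^sub>R c"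
    unfolding v by (simp add: scaleR_add_right)
  finally have "p = (orient b c p / D) *\<^sub>R a + (orient c a p / D) *\<^sub>R b + (orient a b p / D) *\<^sub>R c" .
  moreover have "orient b c p / D + orient c a p / D + orient a b p / D = 1"
    using D s by (simp add: field_simps)
  moreover have "orient b c p / D \<ge> 0" "orient c a p / D \<ge> 0" "orient a b p / D \<ge> 0"
    using D assms by simp_all
  ultimately show ?thesis unfolding convex_hull_3 by blast
qed

lemma convex_position_subset:
  assumes "convex_position P" "Q \<subseteq> P"
  shows "convex_position Q"
  using assms hull_mono[of "Q - {p}" "P - {p}" convex for p] unfolding convex_position_def by blast

text \<open>Of three collinear points one lies between the other two, hence in the hull of the
  rest.\<close>

lemma convex_position_orient:
  assumes "convex_position P" "{a, b, c} \<subseteq> P" "distinct [a, b, c]"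
  shows "orient a b c \<noteq> 0"
proof
  assume "orient a b c = 0"
  then have "collinear {a, b, c}" by (rule orient_eq_0_collinear)
  then have "a \<in> closed_segment b c \<or> b \<in> closed_segment c a \<or> c \<in> closed_segment a b"
    by (simp add: collinear_between_cases between_mem_segment)
  moreover have "z \<notin> closed_segment x y" if "x \<in> P" "y \<in> P" "z \<in> P" "z \<noteq> x" "z \<noteq> y" for x y z
    using assms(1) that hull_mono[of "{x, y}" "P - {z}" convex]
    unfolding convex_position_def segment_convex_hull by blast
  ultimately show False using assms by auto
qed

text \<open>In convex position it is enough that the line \<open>a b\<close> separates
  \<open>c\<close> from \<open>d\<close>: if \<open>a\<close> and \<open>b\<close> lay on the same
  side of the line \<open>c d\<close>, one of them would lie in the triangle of the other three
  points (\<open>no\<close>).\<close>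

lemma convex_position_crossing:
  assumes P: "convex_position P" "{a, b, c, d} \<subseteq> P"
    and "orient a b c > 0" "orient a b d < 0"
  obtains s t where "0 < s" "s < 1" "0 < t" "t < 1"
    "(1 - s) *\<^sub>R a + s *\<^sub>R b = (1 - t) *\<^sub>R c + t *\<^sub>R d"
proof -
  have ne: "a \<noteq> b" "a \<noteq> c" "a \<noteq> d" "b \<noteq> c" "b \<noteq> d" "c \<noteq> d" using assms(3,4) by auto
  have 1: "orient c d a \<noteq> 0" "orient c d b \<noteq> 0"
    using ne P by (intro convex_position_orient[OF P(1)]; auto)+
  have sum: "orient a b c - orient a b d = orient c d b - orient c d a"
    by (simp add: orient_def algebra_simps)
  have no: False if "orient x y u > 0" "orient x y v < 0" "orient u v x > 0" "orient u v y > 0"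
      "{x, y, u, v} \<subseteq> P" for x y u v
  proof -
    have d: "x \<noteq> u" "x \<noteq> v" "x \<noteq> y" using that by auto
    have "x \<in> convex hull {u, v, y}"
      using that orient_rotate[of x v y] orient_swap_right[of x y v] orient_rotate[of x y u] orient_rotate[of y u x]
        orient_rotate[of v y x]
      by (intro mem_triangle) (auto simp: orient_rotate)
    moreover have "{u, v, y} \<subseteq> P - {x}" using d that(5) by blast
    ultimately show False
      using P(1) that(5) hull_mono[of "{u, v, y}" "P - {x}" convex] unfolding convex_position_def by blast
  qed
  have cd: "orient c d b > 0" "orient c d a < 0"
  proof -
    have "\<not> (orient c d a > 0 \<and> orient c d b > 0)" "\<not> (orient c d a < 0 \<and> orient c d b < 0)"
      using no[of a b c d] no[of b a d c] assms by (auto simp: orient_swap[of a b] orient_swap[of c d])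
    then show "orient c d b > 0" "orient c d a < 0" using 1 sum assms(3,4) by linarith+
  qed
  define D where "D = orient a b c - orient a b d"
  have D: "D > 0" using assms by (simp add: D_def)
  \<comment> \<open>The crossing point divides each segment in the ratio of the distances of its
    ends from the other line; by \<open>sum\<close> both ratios have the denominator
    \<open>D\<close>.\<close>
  define s where "s = - orient c d a / D"
  define t where "t = orient a b c / D"
  have "D *\<^sub>R ((1 - s) *\<^sub>R a + s *\<^sub>R b) = (D + orient c d a) *\<^sub>R a - orient c d a *\<^sub>R b"
    using D by (simp add: s_def algebra_simps)
  also have "\<dots> = (D - orient a b c) *\<^sub>R c + orient a b c *\<^sub>R d"
    by (simp add: D_def orient_def vec_eq_iff forall_2 algebra_simps)
  also have "\<dots> = D *\<^sub>R ((1 - t) *\<^sub>R c + t *\<^sub>R d)"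
    using D by (simp add: t_def algebra_simps)
  finally have eq: "(1 - s) *\<^sub>R a + s *\<^sub>R b = (1 - t) *\<^sub>R c + t *\<^sub>R d"
    using D by simp
  have "0 < s" "s < 1" "0 < t" "t < 1"
    using D cd sum assms by (auto simp: s_def t_def D_def field_simps)
  then show ?thesis using eq that by blast
qed

section \<open>Convex sets and the points in their closures\<close>

text \<open>The closure is used because an encapsulating family avoids \<open>P\<close> itself: a
  set matters near \<open>p\<close> exactly when its closure contains \<open>p\<close>.\<close>

definition touched :: "(real^2) set \<Rightarrow> (real^2) set \<Rightarrow> (real^2) set" where
  "touched P K = {p \<in> P. p \<in> closure K}"

lemma collinear_orient:
  assumes "collinear {a, b, c}"
  shows "orient a b c = 0"
proof -
  obtain u where u: "\<forall>x\<in>{a, b, c}. \<forall>y\<in>{a, b, c}. \<exists>k. x - y = k *\<^sub>R u"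
    using assms unfolding collinear_def by blast
  then obtain s t where "b - a = s *\<^sub>R u" "c - a = t *\<^sub>R u" by blast
  then have "b$i - a$i = s * u$i" "c$i - a$i = t * u$i" for i
    by (simp_all add: vec_eq_iff)
  then show ?thesis by (simp add: orient_def)
qed

text \<open>A convex set and its closure have the same interior, so each of the two sets contains
  the whole open triangle.\<close>

lemma common_triangle_meets:
  assumes "convex K" "convex L" "{a, b, c} \<subseteq> closure K" "{a, b, c} \<subseteq> closure L" "orient a b c \<noteq> 0"
  shows "K \<inter> L \<inter> convex hull {a, b, c} \<noteq> {}"
proof -
  have "\<not> collinear {a, b, c}" using assms(5) collinear_orient by blast
  then have "a \<noteq> b" "a \<noteq> c" "b \<noteq> c" "\<not> affine_dependent {a, b, c}"
    by (auto simp: collinear_3_eq_affine_dependent)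
  then have "interior (convex hull {a, b, c}) \<noteq> {}"
    by (subst interior_convex_hull_eq_empty) auto
  moreover
  have "interior (convex hull {a, b, c}) \<subseteq> M"
    if "convex M" "{a, b, c} \<subseteq> closure M" for M
  proof -
    have "convex hull {a, b, c} \<subseteq> closure M"
      using that by (intro hull_minimal convex_closure)
    then have "interior (convex hull {a, b, c}) \<subseteq> interior (closure M)"
      by (rule interior_mono)
    also have "\<dots> \<subseteq> M"
      using that(1) convex_interior_closure interior_subset by blast
    finally show ?thesis .
  qed
  from this[OF assms(1,3)] this[OF assms(2,4)]
  have "interior (convex hull {a, b, c}) \<subseteq> K \<inter> L \<inter> convex hull {a, b, c}"
    using interior_subset by fast
  ultimately show ?thesis by blast
qed

lemma continuous_orient: "continuous_on S (orient a b)"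
  unfolding orient_def by (intro continuous_intros)

text \<open>Two disjoint convex sets near the crossing point of the diagonals would be separated
  by a line containing both diagonals.\<close>

lemma crossing_diagonals_meet:
  assumes P: "convex_position P" "{a, b, c, d} \<subseteq> P"
    and or: "orient a b c > 0" "orient a b d < 0"
    and K: "convex K" "{a, b} \<subseteq> closure K" and L: "convex L" "{c, d} \<subseteq> closure L"
  shows "K \<inter> L \<inter> convex hull P \<noteq> {}"
proof
  assume disj: "K \<inter> L \<inter> convex hull P = {}"
  obtain s t where st: "0 < s" "s < 1" "0 < t" "t < 1"
    and eq: "(1 - s) *\<^sub>R a + s *\<^sub>R b = (1 - t) *\<^sub>R c + t *\<^sub>R d"
    using convex_position_crossing[OF P or] by blast
  define z where "z = (1 - s) *\<^sub>R a + s *\<^sub>R b"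
  have z': "z = (1 - t) *\<^sub>R c + t *\<^sub>R d" using eq z_def by simp
  \<comment> \<open>The open quadrilateral \<open>a d b c\<close>, counterclockwise. It yields a
    ball around the crossing point inside the hull, where the two sets are known to be
    disjoint.\<close>
  define U where "U = {p. orient b c p > 0 \<and> orient c a p > 0 \<and> orient a d p > 0 \<and> orient d b p > 0}"
  have "open U"
    unfolding U_def by (intro open_Collect_conj open_Collect_less continuous_intros continuous_orient)
  moreover have "z \<in> U"
    unfolding z_def U_def using st or
    by (auto simp: orient_combination orient_rotate[of b c a] orient_rotate[of c a b]
      orient_swap_right[of a d b] orient_rotate[of d b a] mult_pos_neg)
  moreover have U: "U \<subseteq> convex hull P"
  proof
    fix p assume p: "p \<in> U"
    have "p \<in> convex hull {a, b, c} \<or> p \<in> convex hull {b, a, d}"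
      using p or mem_triangle[of a b c p] mem_triangle[of b a d p] orient_swap[of a b]
      by (cases "orient a b p \<ge> 0") (auto simp: U_def orient_swap[of a b])
    then show "p \<in> convex hull P"
      using hull_mono[of "{a, b, c}" P convex] hull_mono[of "{b, a, d}" P convex] P(2) by auto
  qed
  ultimately obtain e where e: "e > 0" "ball z e \<subseteq> convex hull P"
    unfolding open_contains_ball by blast
  have near: "w \<in> closure (ball z e \<inter> M)" if "w \<in> ball z e" "w \<in> closure M" for w and M :: "(real^2) set"
    using open_Int_closure_subset[of "ball z e" M] that by auto
  have zK: "z \<in> closure K"
    using K st convex_closure[OF K(1)] unfolding z_def by (intro convexD) auto
  have zL: "z \<in> closure L"
    using L st convex_closure[OF L(1)] unfolding z' by (intro convexD) auto
  have "z \<in> ball z e" using e by simp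
  then have "ball z e \<inter> K \<noteq> {}" "ball z e \<inter> L \<noteq> {}"
    using near[of z K] near[of z L] zK zL by auto
  moreover have "(ball z e \<inter> K) \<inter> (ball z e \<inter> L) = {}" using disj e by auto
  moreover have "convex (ball z e \<inter> K)" "convex (ball z e \<inter> L)"
    using K L by (auto intro: convex_Int)
  ultimately obtain n \<beta> where n: "n \<noteq> 0" "\<forall>x\<in>ball z e \<inter> K. n \<bullet> x \<le> \<beta>" "\<forall>x\<in>ball z e \<inter> L. n \<bullet> x \<ge> \<beta>"
    using separating_hyperplane_sets[of "ball z e \<inter> K" "ball z e \<inter> L"] by blast
  have nK: "n \<bullet> w \<le> \<beta>" if "w \<in> ball z e" "w \<in> closure K" for w
    using near[OF that] n(2) closure_minimal[of "ball z e \<inter> K" "{x. n \<bullet> x \<le> \<beta>}"] closed_halfspace_le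
    by blast
  have nL: "n \<bullet> w \<ge> \<beta>" if "w \<in> ball z e" "w \<in> closure L" for w
    using near[OF that] n(3) closure_minimal[of "ball z e \<inter> L" "{x. n \<bullet> x \<ge> \<beta>}"] closed_halfspace_ge
    by blast
  have nz: "n \<bullet> z = \<beta>" using nK[of z] nL[of z] zK zL e by simp
  \<comment> \<open>Near \<open>z\<close> the segment from \<open>x\<close> to \<open>y\<close> runs
    in the closure of \<open>M\<close> in both directions, on one side of a line through
    \<open>z\<close>; so it runs along that line.\<close>
  have perp: "n \<bullet> (y - x) = 0"
    if M: "convex M" "x \<in> closure M" "y \<in> closure M" and r: "0 < r" "r < 1" "z = (1 - r) *\<^sub>R x + r *\<^sub>R y"
      and sgn: "(\<forall>w. w \<in> ball z e \<longrightarrow> w \<in> closure M \<longrightarrow> n \<bullet> w \<le> \<beta>) \<or> (\<forall>w. w \<in> ball z e \<longrightarrow> w \<in> closure M \<longrightarrow> n \<bullet> w \<ge> \<beta>)"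
    for x y r M
  proof -
    have "norm (y - x) + 1 > 0" by (smt (verit) norm_ge_zero)
    \<comment> \<open>A step short enough to stay in the segment and in the ball; the summand 1
      guards against a zero denominator.\<close>
    define k where "k = min (min r (1 - r)) (e / (norm (y - x) + 1))"
    have k: "k > 0" "k \<le> r" "k \<le> 1 - r" using r e \<open>norm (y - x) + 1 > 0\<close> by (auto simp: k_def)
    have "k * norm (y - x) < k * (norm (y - x) + 1)" using k by simp
    also have "\<dots> \<le> e / (norm (y - x) + 1) * (norm (y - x) + 1)"
      using \<open>norm (y - x) + 1 > 0\<close> by (intro mult_right_mono) (auto simp: k_def)
    also have "\<dots> = e" using \<open>norm (y - x) + 1 > 0\<close> by simp
    finally have ke: "k * norm (y - x) < e" .
    have "z + k *\<^sub>R (y - x) = (1 - (r + k)) *\<^sub>R x + (r + k) *\<^sub>R y"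
      "z - k *\<^sub>R (y - x) = (1 - (r - k)) *\<^sub>R x + (r - k) *\<^sub>R y"
      unfolding r(3) by (simp_all add: algebra_simps)
    moreover have "(1 - (r + k)) *\<^sub>R x + (r + k) *\<^sub>R y \<in> closure M"
      "(1 - (r - k)) *\<^sub>R x + (r - k) *\<^sub>R y \<in> closure M"
      using convex_closure[OF M(1)] M k r by (intro convexD; simp)+
    ultimately have "z + k *\<^sub>R (y - x) \<in> closure M" "z - k *\<^sub>R (y - x) \<in> closure M"
      by simp_all
    moreover have "z + k *\<^sub>R (y - x) \<in> ball z e" "z - k *\<^sub>R (y - x) \<in> ball z e"
      using ke k by (simp_all add: dist_norm)
    ultimately have "n \<bullet> (z + k *\<^sub>R (y - x)) \<le> \<beta> \<and> n \<bullet> (z - k *\<^sub>R (y - x)) \<le> \<beta> \<or>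
        n \<bullet> (z + k *\<^sub>R (y - x)) \<ge> \<beta> \<and> n \<bullet> (z - k *\<^sub>R (y - x)) \<ge> \<beta>"
      using sgn by meson
    moreover have "n \<bullet> (z + k *\<^sub>R (y - x)) = \<beta> + k * (n \<bullet> (y - x))"
      "n \<bullet> (z - k *\<^sub>R (y - x)) = \<beta> - k * (n \<bullet> (y - x))"
      by (simp_all only: inner_add_right inner_diff_right[of n z] inner_scaleR_right nz)
    ultimately have "k * (n \<bullet> (y - x)) \<le> 0 \<and> - (k * (n \<bullet> (y - x))) \<le> 0 \<or>
        k * (n \<bullet> (y - x)) \<ge> 0 \<and> - (k * (n \<bullet> (y - x))) \<ge> 0"
      by linarith
    then have "k * (n \<bullet> (y - x)) = 0" by linarith
    then show ?thesis using k by simp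
  qed
  have ab: "n \<bullet> (b - a) = 0" using perp[OF K(1) _ _ st(1,2) z_def] K(2) nK by simp
  have cd: "n \<bullet> (d - c) = 0" using perp[OF L(1) _ _ st(3,4) z'] L(2) nL by simp
  \<comment> \<open>The cross product of \<open>b - a\<close> and \<open>d - c\<close>. As it is
    nonzero, only the zero vector is orthogonal to both diagonals.\<close>
  define X where "X = orient a b d - orient a b c"
  have X: "X \<noteq> 0" using or by (simp add: X_def)
  have X': "X = (b$1 - a$1) * (d$2 - c$2) - (b$2 - a$2) * (d$1 - c$1)"
    by (simp add: X_def orient_def algebra_simps)
  have e1: "n$1 * (b$1 - a$1) + n$2 * (b$2 - a$2) = 0"
    using ab by (simp add: inner_vec_def sum_2)
  have e2: "n$1 * (d$1 - c$1) + n$2 * (d$2 - c$2) = 0"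
    using cd by (simp add: inner_vec_def sum_2)
  have "n$1 * X = 0" "n$2 * X = 0" unfolding X' using e1 e2 by algebra+
  then have "n = 0" using X by (simp add: vec_eq_iff forall_2)
  with n(1) show False by simp
qed

section \<open>Encapsulation of a single point\<close>

lemma encapsulates_point_not_mem:
  assumes "encapsulates_point \<K> p"
  shows "p \<notin> \<Union>\<K>"
  using assms interior_subset unfolding encapsulates_point_def by fastforce

text \<open>Finitely many closures that miss \<open>p\<close> have a closed union, and the
  neighborhood can be shrunk into its complement.\<close>

lemma encapsulates_point_remove:
  assumes "encapsulates_point \<K> p" "finite \<F>" "\<And>K. K \<in> \<F> \<Longrightarrow> p \<notin> closure K"
  shows "encapsulates_point (\<K> - \<F>) p"
proof -
  obtain N where N: "p \<in> interior N" "\<Union>\<K> \<inter> N = N - {p}"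
    using assms(1) unfolding encapsulates_point_def by blast
  define W where "W = - (\<Union>K\<in>\<F>. closure K)"
  have "open W" unfolding W_def using assms(2) by (intro open_Compl closed_UN) auto
  then have "p \<in> interior (N \<inter> W)"
    using N(1) assms(3) by (simp add: interior_open W_def)
  moreover have "x \<notin> W" if "x \<in> K" "K \<in> \<F>" for x K
    using that closure_subset[of K] by (auto simp: W_def)
  then have "\<Union>(\<K> - \<F>) \<inter> (N \<inter> W) = N \<inter> W - {p}" using N(2) by blast
  ultimately show ?thesis unfolding encapsulates_point_def by blast
qed

text \<open>Once the sets away from \<open>p\<close> are discarded, a single remaining set would
  contain \<open>p + h\<close> and \<open>p - h\<close>, hence their midpoint
  \<open>p\<close>.\<close>

lemma encapsulates_point_two_sets:
  assumes enc: "encapsulates_point \<K> p" and fin: "finite \<K>" and cvx: "\<forall>K\<in>\<K>. convex K"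
  shows "\<exists>K\<in>\<K>. \<exists>L\<in>\<K>. K \<noteq> L \<and> p \<in> closure K \<and> p \<in> closure L"
proof (rule ccontr)
  assume no: "\<not> ?thesis"
  define \<F> where "\<F> = {K \<in> \<K>. p \<notin> closure K}"
  have one: "K = L" if "K \<in> \<K> - \<F>" "L \<in> \<K> - \<F>" for K L
    using that no unfolding \<F>_def by blast
  have "encapsulates_point (\<K> - \<F>) p"
    using enc fin by (intro encapsulates_point_remove) (auto simp: \<F>_def)
  then obtain N where N: "p \<in> interior N" "\<Union>(\<K> - \<F>) \<inter> N = N - {p}"
    unfolding encapsulates_point_def by blast
  then obtain e where e: "e > 0" "ball p e \<subseteq> N" using mem_interior by blast
  define h :: "real^2" where "h = (e / 2) *\<^sub>R axis 1 1"
  have h: "norm h = e / 2" using e by (simp add: h_def)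
  then have "p + h \<in> N - {p}" "p - h \<in> N - {p}" using e by (auto simp: dist_norm subset_iff)
  then obtain K L where "K \<in> \<K> - \<F>" "L \<in> \<K> - \<F>" "p + h \<in> K" "p - h \<in> L" using N(2) by blast
  with one have K: "K \<in> \<K>" "p + h \<in> K" "p - h \<in> K" by auto
  have "(1 / 2) *\<^sub>R (p + h) + (1 / 2) *\<^sub>R (p - h) \<in> K"
    using K cvx by (intro convexD) auto
  moreover have "(1 / 2) *\<^sub>R (p + h) + (1 / 2) *\<^sub>R (p - h) = p"
    by (simp add: scaleR_add_right[symmetric] scaleR_2[symmetric])
  ultimately show False using K(1) encapsulates_point_not_mem[OF enc] by auto
qed

section \<open>Pushing the points away from a common point\<close>

lemma barycentric_coordinates:
  assumes "orient x y z \<noteq> 0"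
  obtains u v w where "u + v + w = 1" "c = u *\<^sub>R x + v *\<^sub>R y + w *\<^sub>R z"
proof
  define D where "D = orient x y z"
  have D: "D \<noteq> 0" using assms by (simp add: D_def)
  have s: "orient y z c + orient z x c + orient x y c = D"
    by (simp add: D_def orient_def algebra_simps)
  have v: "D *\<^sub>R c = orient y z c *\<^sub>R x + orient z x c *\<^sub>R y + orient x y c *\<^sub>R z"
    by (simp add: D_def orient_def vec_eq_iff forall_2 algebra_simps)
  show "orient y z c / D + orient z x c / D + orient x y c / D = 1"
    using D s by (simp add: field_simps)
  have "c = (1 / D) *\<^sub>R (D *\<^sub>R c)" using D by simp
  also have "\<dots> = (orient y z c / D) *\<^sub>R x + (orient z x c / D) *\<^sub>R y + (orient x y c / D) *\<^sub>R z"
    unfolding v by (simp add: scaleR_add_right)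
  finally show "c = (orient y z c / D) *\<^sub>R x + (orient z x c / D) *\<^sub>R y + (orient x y c / D) *\<^sub>R z" .
qed

text \<open>Writing \<open>c\<close> as a mixture of \<open>z\<close> and a point \<open>q\<close>
  of the hull of the others, an expression of \<open>z\<close> by \<open>c\<close>,
  \<open>x\<close>, \<open>y\<close> can be solved for \<open>z\<close>, which then lies in the hull
  of the others.\<close>

lemma convex_position_not_mem_hull_insert:
  assumes P: "convex_position P" "z \<in> P" "{x, y} \<subseteq> P - {z}" and c: "c \<in> convex hull P" "c \<noteq> z"
  shows "z \<notin> convex hull {c, x, y}"
proof
  assume "z \<in> convex hull {c, x, y}"
  define Q where "Q = P - {z}"
  have Q: "Q \<noteq> {}" "insert z Q = P" using P by (auto simp: Q_def)
  have zQ: "z \<notin> convex hull Q" using P by (auto simp: convex_position_def Q_def)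
  obtain l q where l: "0 \<le> l" "l \<le> 1" "q \<in> convex hull Q" "c = (1 - l) *\<^sub>R z + l *\<^sub>R q"
    using c(1) unfolding Q(2)[symmetric] convex_hull_insert_alt using Q(1) by auto
  have l0: "l \<noteq> 0" using l(4) c(2) by auto
  obtain k r where k: "0 \<le> k" "k \<le> 1" "r \<in> convex hull {x, y}" "z = (1 - k) *\<^sub>R c + k *\<^sub>R r"
    using \<open>z \<in> convex hull {c, x, y}\<close> unfolding convex_hull_insert_alt[of c "{x, y}"] by auto
  have r: "r \<in> convex hull Q" using k(3) hull_mono[of "{x, y}" Q convex] P(3) by (auto simp: Q_def)
  \<comment> \<open>The total weight of \<open>q\<close> and \<open>r\<close> after substituting for
    \<open>c\<close>; it is positive because \<open>c \<noteq> z\<close> gives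
    \<open>l > 0\<close>.\<close>
  define m where "m = (1 - k) * l + k"
  have "m \<ge> l" using l k by (simp add: m_def algebra_simps mult_left_le)
  then have m: "m > 0" using l l0 by linarith
  have "m *\<^sub>R z = ((1 - k) * l) *\<^sub>R q + k *\<^sub>R r"
  proof -
    have "z = (1 - m) *\<^sub>R z + ((1 - k) * l) *\<^sub>R q + k *\<^sub>R r"
      by (subst (1) k(4)) (simp add: l(4) m_def algebra_simps)
    then show ?thesis by (simp add: algebra_simps)
  qed
  then have "(1 / m) *\<^sub>R (m *\<^sub>R z) = ((1 - k) * l / m) *\<^sub>R q + (k / m) *\<^sub>R r"
    by (simp add: scaleR_add_right)
  then have "z = ((1 - k) * l / m) *\<^sub>R q + (k / m) *\<^sub>R r" using m by simp
  moreover have "((1 - k) * l / m) *\<^sub>R q + (k / m) *\<^sub>R r \<in> convex hull Q"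
  proof (intro convexD[OF convex_convex_hull] l(3) r)
    show "(1 - k) * l / m + k / m = 1"
      using m unfolding add_divide_distrib[symmetric] m_def[symmetric] by simp
  qed (use m l k in auto)
  ultimately show False using zQ by simp
qed

text \<open>The homothety with center \<open>c\<close> and ratio \<open>1 + e\<close>.\<close>

definition push :: "real^2 \<Rightarrow> real \<Rightarrow> real^2 \<Rightarrow> real^2" where
  "push c e p = p + e *\<^sub>R (p - c)"

text \<open>The homothety fixes \<open>c\<close>, so \<open>c\<close> has the same coordinates
  \<open>u\<close>, \<open>v\<close>, \<open>w\<close> in the pushed triangle. As \<open>z\<close>
  is the mixture of its image and \<open>c\<close> with weights 1 and \<open>e\<close> over
  \<open>1 + e\<close>, its coordinates are \<open>e * u\<close>, \<open>e * v\<close> and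
  \<open>1 + e * w\<close> over \<open>1 + e\<close>; the last is positive for small
  \<open>e\<close> even if \<open>w\<close> is negative.\<close>

lemma push_triangle_nonneg:
  assumes "u + v + w = 1" "c = u *\<^sub>R x + v *\<^sub>R y + w *\<^sub>R z" "u \<ge> 0" "v \<ge> 0"
  shows "\<forall>\<^sub>F e in at_right 0. z \<in> convex hull {push c e x, push c e y, push c e z}"
proof -
  have "\<forall>\<^sub>F e in at_right 0. e < 1 / (\<bar>w\<bar> + 1) \<and> e > (0::real)"
    by (auto simp: eventually_at_right_less intro!: eventually_conj eventually_at_rightI[of 0 "1 / (\<bar>w\<bar> + 1)"])
  then show ?thesis
  proof eventually_elim
    case (elim e)
    have "e * (\<bar>w\<bar> + 1) < 1" using elim by (simp add: field_simps)
    moreover have "- (e * w) \<le> e * (\<bar>w\<bar> + 1)"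
      using elim mult_left_mono[of "- w" "\<bar>w\<bar> + 1" e] by simp
    ultimately have ew: "1 + e * w > 0" by linarith
    have e1: "1 + e > 0" using elim by simp
    have w: "w = 1 - u - v" using assms(1) by simp
    have "(1 + e) *\<^sub>R z = (e * u) *\<^sub>R push c e x + (e * v) *\<^sub>R push c e y + (1 + e * w) *\<^sub>R push c e z"
      unfolding push_def assms(2) w by (simp add: algebra_simps)
    then have "(1 / (1 + e)) *\<^sub>R ((1 + e) *\<^sub>R z) = (e * u / (1 + e)) *\<^sub>R push c e x + (e * v / (1 + e)) *\<^sub>R push c e y
        + ((1 + e * w) / (1 + e)) *\<^sub>R push c e z"
      by (simp add: scaleR_add_right)
    then have "z = (e * u / (1 + e)) *\<^sub>R push c e x + (e * v / (1 + e)) *\<^sub>R push c e y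
        + ((1 + e * w) / (1 + e)) *\<^sub>R push c e z"
      using e1 by simp
    moreover have "e * u / (1 + e) + e * v / (1 + e) + (1 + e * w) / (1 + e) = 1"
      using e1 by (simp add: w add_divide_distrib[symmetric] algebra_simps)
    moreover have "e * u / (1 + e) \<ge> 0" "e * v / (1 + e) \<ge> 0" "(1 + e * w) / (1 + e) \<ge> 0"
      using assms(3,4) elim ew e1 by simp_all
    ultimately show ?case unfolding convex_hull_3 by blast
  qed
qed

text \<open>Two negative coordinates of \<open>c\<close> would put the third vertex into the
  triangle of \<open>c\<close> and the other two, so at least two are nonnegative. Hence a convex
  set containing three pushed points contains a point of \<open>P\<close>.\<close>

lemma push_triangle:
  assumes P: "convex_position P" "{x, y, z} \<subseteq> P" "distinct [x, y, z]" and c: "c \<in> convex hull P" "c \<notin> P"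
  shows "\<forall>\<^sub>F e in at_right 0. \<exists>p\<in>{x, y, z}. p \<in> convex hull {push c e x, push c e y, push c e z}"
proof -
  obtain u v w where b: "u + v + w = 1" "c = u *\<^sub>R x + v *\<^sub>R y + w *\<^sub>R z"
    using barycentric_coordinates[OF convex_position_orient[OF P]] by blast
  have no: False if "u < 0" "v < 0" "u + v + w = 1" "c = u *\<^sub>R x + v *\<^sub>R y + w *\<^sub>R z"
    "{x, y, z} \<subseteq> P" "distinct [x, y, z]" for u v w x y z
  proof -
    have w: "w > 1" using that by simp
    have "w *\<^sub>R z = c - u *\<^sub>R x - v *\<^sub>R y" using that(4) by simp
    then have "(1 / w) *\<^sub>R (w *\<^sub>R z) = (1 / w) *\<^sub>R c + (- u / w) *\<^sub>R x + (- v / w) *\<^sub>R y"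
      by (simp add: scaleR_diff_right)
    then have "z = (1 / w) *\<^sub>R c + (- u / w) *\<^sub>R x + (- v / w) *\<^sub>R y" using w by simp
    moreover have "1 / w + - u / w + - v / w = (1 - u - v) / w" by (simp add: diff_divide_distrib)
    then have "1 / w + - u / w + - v / w = 1" using that(3) w by simp
    moreover have "1 / w \<ge> 0" "- u / w \<ge> 0" "- v / w \<ge> 0"
      using that w by (auto simp: divide_le_0_iff)
    ultimately have "z \<in> convex hull {c, x, y}" unfolding convex_hull_3 by blast
    moreover have "c \<noteq> z" using that(5) c(2) by blast
    then have "z \<notin> convex hull {c, x, y}"
      using that(5,6) c(1) by (intro convex_position_not_mem_hull_insert[OF P(1)]) auto
    ultimately show False by blast
  qed
  consider "u \<ge> 0" "v \<ge> 0" | "v \<ge> 0" "w \<ge> 0" | "w \<ge> 0" "u \<ge> 0"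
    using no[of u v w x y z] no[of v w u y z x] no[of w u v z x y] b P by (force simp: algebra_simps)
  then show ?thesis
  proof cases
    case 1
    from push_triangle_nonneg[OF b 1] show ?thesis by eventually_elim blast
  next
    case 2
    have "v + w + u = 1" "c = v *\<^sub>R y + w *\<^sub>R z + u *\<^sub>R x" using b by (simp_all add: algebra_simps)
    from push_triangle_nonneg[OF this 2] show ?thesis by eventually_elim (auto simp: insert_commute)
  next
    case 3
    have "w + u + v = 1" "c = w *\<^sub>R z + u *\<^sub>R x + v *\<^sub>R y" using b by (simp_all add: algebra_simps)
    from push_triangle_nonneg[OF this 3] show ?thesis by eventually_elim (auto simp: insert_commute)
  qed
qed

lemma encapsulates_point_push:
  assumes "encapsulates_point \<K> p" "c \<noteq> p"
  shows "\<forall>\<^sub>F e in at_right 0. push c e p \<in> \<Union>\<K>"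
proof -
  obtain N where N: "p \<in> interior N" "\<Union>\<K> \<inter> N = N - {p}"
    using assms(1) unfolding encapsulates_point_def by blast
  have "((\<lambda>e. push c e p) \<longlongrightarrow> push c 0 p) (at_right 0)"
    unfolding push_def by (intro tendsto_intros)
  then have "\<forall>\<^sub>F e in at_right 0. push c e p \<in> interior N"
    using N(1) by (intro topological_tendstoD) (auto simp: push_def)
  moreover have "\<forall>\<^sub>F e in at_right 0. e > (0::real)" by (simp add: eventually_at_right_less)
  ultimately show ?thesis
  proof eventually_elim
    case (elim e)
    then have "push c e p \<in> N - {p}" using interior_subset assms(2) by (auto simp: push_def)
    then show ?case using N(2) by blast
  qed
qed

text \<open>Move every point of \<open>P\<close> slightly away from the common point \<open>c\<close>: the sets containing \<open>c\<close>
  contain none of the moved points, and every other set contains at most two of them.\<close>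

lemma card_le_of_common_point:
  assumes P: "finite P" "convex_position P" and K: "finite \<K>" "\<forall>K\<in>\<K>. convex K" "encapsulates \<K> P"
    and KL: "K \<in> \<K>" "L \<in> \<K>" "K \<noteq> L" "c \<in> K" "c \<in> L" "c \<in> convex hull P"
  shows "card P \<le> 2 * (card \<K> - 2)"
proof -
  have enc: "encapsulates_point \<K> p" if "p \<in> P" for p
    using K(3) that by (simp add: encapsulates_def)
  have notin: "p \<notin> M" if "p \<in> P" "M \<in> \<K>" for p M
    using encapsulates_point_not_mem[OF enc[OF that(1)]] that(2) by blast
  have cP: "c \<notin> P" using notin KL by blast
  define T where "T = {(x, y, z). {x, y, z} \<subseteq> P \<and> distinct [x, y, z]}"
  have "finite T"
    using P(1) by (intro finite_subset[of T "P \<times> P \<times> P"]) (auto simp: T_def)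
  then have "\<forall>\<^sub>F e in at_right 0. \<forall>(x, y, z)\<in>T. \<exists>p\<in>{x, y, z}. p \<in> convex hull {push c e x, push c e y, push c e z}"
    using push_triangle[OF P(2) _ _ KL(6) cP] by (intro eventually_ball_finite) (auto simp: T_def)
  moreover have "\<forall>\<^sub>F e in at_right 0. \<forall>p\<in>P. push c e p \<in> \<Union>\<K>"
  proof (intro eventually_ball_finite ballI P(1))
    fix p assume p: "p \<in> P"
    with cP have "c \<noteq> p" by blast
    with enc[OF p] show "\<forall>\<^sub>F e in at_right 0. push c e p \<in> \<Union>\<K>" by (rule encapsulates_point_push)
  qed
  moreover have "\<forall>\<^sub>F e in at_right 0. e > (0::real)" by (simp add: eventually_at_right_less)
  ultimately have "\<forall>\<^sub>F e in at_right 0. e > 0 \<and> (\<forall>p\<in>P. push c e p \<in> \<Union>\<K>) \<and>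
      (\<forall>(x, y, z)\<in>T. \<exists>p\<in>{x, y, z}. p \<in> convex hull {push c e x, push c e y, push c e z})"
    by eventually_elim blast
  \<comment> \<open>There are finitely many points and triples, so one \<open>e\<close> serves them
    all.\<close>
  then obtain e where e: "e > 0" "\<forall>p\<in>P. push c e p \<in> \<Union>\<K>"
      "\<forall>(x, y, z)\<in>T. \<exists>p\<in>{x, y, z}. p \<in> convex hull {push c e x, push c e y, push c e z}"
    using eventually_happens[of _ "at_right (0::real)"] trivial_limit_at_right_real by blast
  define S where "S M = {p \<in> P. push c e p \<in> M}" for M
  have card2: "card (S M) \<le> 2" if "M \<in> \<K>" for M
  proof (rule ccontr)
    assume "\<not> card (S M) \<le> 2"
    then obtain Q where "Q \<subseteq> S M" "card Q = 3" using obtain_subset_with_card_n[of 3 "S M"] by auto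
    then obtain x y z where xyz: "{x, y, z} \<subseteq> S M" "distinct [x, y, z]"
      by (auto simp: card_3_iff)
    then have "(x, y, z) \<in> T" by (auto simp: T_def S_def)
    then obtain p where p: "p \<in> {x, y, z}" "p \<in> convex hull {push c e x, push c e y, push c e z}"
      using e(3) by fast
    have "convex hull {push c e x, push c e y, push c e z} \<subseteq> M"
      using xyz K(2) that by (intro hull_minimal) (auto simp: S_def)
    then show False using p xyz notin[OF _ that, of p] by (auto simp: S_def)
  qed
  have empty: "S M = {}" if "M \<in> \<K>" "c \<in> M" for M
  proof (rule ccontr)
    assume "S M \<noteq> {}"
    then obtain p where p: "p \<in> P" "push c e p \<in> M" by (auto simp: S_def)
    \<comment> \<open>The original point \<open>p\<close> lies on the segment from \<open>c\<close>
      to its pushed copy.\<close>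
    have "(1 / (1 + e)) *\<^sub>R push c e p + (e / (1 + e)) *\<^sub>R c \<in> M"
      using p that K(2) e(1) by (intro convexD) (auto simp: field_simps)
    moreover have "push c e p = (1 + e) *\<^sub>R p - e *\<^sub>R c" by (simp add: push_def algebra_simps)
    then have "(1 / (1 + e)) *\<^sub>R push c e p + (e / (1 + e)) *\<^sub>R c = p"
      using e(1) by (simp add: scaleR_diff_right)
    ultimately show False using notin p that by simp
  qed
  have "P \<subseteq> (\<Union>M\<in>\<K> - {K, L}. S M)"
  proof
    fix p assume p: "p \<in> P"
    then obtain M where M: "M \<in> \<K>" "push c e p \<in> M" using e(2) by blast
    with p have "p \<in> S M" by (simp add: S_def)
    with M empty KL show "p \<in> (\<Union>M\<in>\<K> - {K, L}. S M)" by blast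
  qed
  then have "card P \<le> card (\<Union>M\<in>\<K> - {K, L}. S M)"
    using K(1) P(1) by (intro card_mono) (auto simp: S_def)
  also have "\<dots> \<le> (\<Sum>M\<in>\<K> - {K, L}. card (S M))"
    using K(1) by (intro card_UN_le) auto
  also have "\<dots> \<le> (\<Sum>M\<in>\<K> - {K, L}. 2)"
    using card2 by (intro sum_mono) auto
  also have "\<dots> = 2 * (card \<K> - 2)"
    using KL K(1) by (simp add: card_Diff_subset)
  finally show ?thesis .
qed

section \<open>Disjoint sets: one of them touches at most two points\<close>

lemma touched_not_crossing:
  assumes "convex_position P" "convex K" "convex L" "K \<inter> L \<inter> convex hull P = {}"
    and "{a, b} \<subseteq> touched P K" "{c, d} \<subseteq> touched P L"
  shows "\<not> (orient a b c > 0 \<and> orient a b d < 0)"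
  using crossing_diagonals_meet[of P a b c d K L] assms unfolding touched_def by blast

text \<open>If no side of the triangle has points of \<open>P\<close> strictly on both sides, all of
  \<open>P\<close> lies in the triangle, and convex position leaves only the vertices.\<close>

lemma supporting_triangle:
  assumes P: "convex_position P" "{x, y, z} \<subseteq> P" "distinct [x, y, z]"
    and supp: "\<And>u v. {u, v} \<subseteq> {x, y, z} \<Longrightarrow> (\<forall>p\<in>P. orient u v p \<le> 0) \<or> (\<forall>p\<in>P. orient v u p \<le> 0)"
  shows "P = {x, y, z}"
proof -
  have main: "P \<subseteq> {x, y, z}" if "orient x y z > 0" "{x, y, z} \<subseteq> P"
      "\<And>u v. {u, v} \<subseteq> {x, y, z} \<Longrightarrow> (\<forall>p\<in>P. orient u v p \<le> 0) \<or> (\<forall>p\<in>P. orient v u p \<le> 0)"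
    for x y z
  proof
    fix p assume p: "p \<in> P"
    have "\<forall>p\<in>P. orient y x p \<le> 0"
      using that(3)[of x y] that(1,2) by force
    moreover have "\<forall>p\<in>P. orient z y p \<le> 0"
      using that(3)[of y z] that(1,2) orient_rotate[of y z x] by force
    moreover have "\<forall>p\<in>P. orient x z p \<le> 0"
      using that(3)[of z x] that(1,2) orient_rotate[of x y z] by force
    ultimately have "p \<in> convex hull {x, y, z}"
      using that(1) p orient_swap[of x y p] orient_swap[of y z p] orient_swap[of z x p]
      by (intro mem_triangle) auto
    then show "p \<in> {x, y, z}"
      using P(1) p that(2) hull_mono[of "{x, y, z}" "P - {p}" convex] unfolding convex_position_def by blast
  qed
  have "orient x y z \<noteq> 0" by (rule convex_position_orient[OF P])
  then consider "orient x y z > 0" | "orient x z y > 0" using orient_swap_right[of x y z] by linarith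
  then show ?thesis
  proof cases
    case 1
    then show ?thesis using main[of x y z] P(2) supp by blast
  next
    case 2
    then have "P \<subseteq> {x, z, y}" using P(2) supp by (intro main) (auto simp: insert_commute)
    then show ?thesis using P(2) by auto
  qed
qed

text \<open>Among all lines through two points touched by a common set take one cutting off the fewest
  points, but at least one. If every set touched three points, then any set touching a point that is
  cut off would, together with the two points on the line, give two sets touching the same triangle.\<close>

lemma ex_touched_le_2:
  assumes P: "finite P" "convex_position P" "card P \<ge> 4" and cvx: "\<And>K. K \<in> \<K> \<Longrightarrow> convex K"
    and disj: "\<And>K L. K \<in> \<K> \<Longrightarrow> L \<in> \<K> \<Longrightarrow> K \<noteq> L \<Longrightarrow> K \<inter> L \<inter> convex hull P = {}"
    and two: "\<And>p. p \<in> P \<Longrightarrow> \<exists>K\<in>\<K>. \<exists>L\<in>\<K>. K \<noteq> L \<and> p \<in> closure K \<and> p \<in> closure L"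
  shows "\<exists>K\<in>\<K>. card (touched P K) \<le> 2"
proof (rule ccontr)
  assume "\<not> ?thesis"
  then have three: "card (touched P K) \<ge> 3" if "K \<in> \<K>" for K using that by force
  have T: "touched P K \<subseteq> P" "finite (touched P K)" for K
    using P(1) by (auto simp: touched_def)
  have third: "\<exists>w\<in>touched P K. w \<noteq> x \<and> w \<noteq> y" if "K \<in> \<K>" for K x y
  proof (rule ccontr)
    assume "\<not> ?thesis"
    then have "touched P K \<subseteq> {x, y}" by blast
    then have "card (touched P K) \<le> card {x, y}" by (intro card_mono) auto
    also have "\<dots> \<le> 2" by (simp add: card_insert_if)
    finally show False using three[OF that] by simp
  qed
  define C where "C i j = {p \<in> P. orient i j p > 0}" for i j
  define good where "good t = (case t of (K, i, j) \<Rightarrow>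
    K \<in> \<K> \<and> i \<in> touched P K \<and> j \<in> touched P K \<and> C i j \<noteq> {})" for t
  define m where "m t = (case t of (K :: (real^2) set, i, j) \<Rightarrow> card (C i j))" for t
  have "P \<noteq> {}" using P(3) by auto
  then obtain K where "K \<in> \<K>" using two by blast
  moreover obtain x where "x \<in> touched P K" using third[OF \<open>K \<in> \<K>\<close>] by blast
  moreover obtain y where "y \<in> touched P K" "y \<noteq> x" using third[OF \<open>K \<in> \<K>\<close>] by blast
  moreover obtain z where "z \<in> touched P K" "z \<noteq> x" "z \<noteq> y" using third[OF \<open>K \<in> \<K>\<close>] by blast
  moreover have "orient x y z \<noteq> 0"
    using calculation T by (intro convex_position_orient[OF P(2)]) auto
  then have "C x y \<noteq> {} \<or> C y x \<noteq> {}"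
    using calculation T orient_swap[of y x z] unfolding C_def
    by (metis (mono_tags, lifting) empty_iff linorder_neqE_linordered_idom mem_Collect_eq neg_0_less_iff_less subsetD)
  ultimately have "\<exists>t. good t" unfolding good_def by auto
  then obtain t where t: "good t" "\<forall>t'. good t' \<longrightarrow> m t \<le> m t'" using ex_has_least_nat by metis
  obtain K i j where Kij: "t = (K, i, j)" by (cases t)
  have K: "K \<in> \<K>" and ij: "i \<in> touched P K" "j \<in> touched P K" and ne: "C i j \<noteq> {}"
    using t(1) by (auto simp: Kij good_def)
  have least: "C x y = {}" if "Q \<in> \<K>" "x \<in> touched P Q" "y \<in> touched P Q" "card (C x y) < card (C i j)" for Q x y
    using t(2)[rule_format, of "(Q, x, y)"] that by (auto simp: Kij good_def m_def)
  have iP: "i \<in> P" "j \<in> P" using ij T by auto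
  have "i \<noteq> j" using ne by (auto simp: C_def)
  \<comment> \<open>A set other than \<open>K\<close> that touches points on both sides of the line
    \<open>i j\<close> would have a segment crossing the segment \<open>i j\<close> of
    \<open>K\<close>.\<close>
  have not_right: "orient i j u \<ge> 0" if "Q \<in> \<K>" "Q \<noteq> K" "b \<in> touched P Q" "u \<in> touched P Q" "orient i j b > 0" for Q b u
    using touched_not_crossing[OF P(2) cvx[OF K] cvx[OF that(1)] disj, of i j b u] K ij that by force
  \<comment> \<open>The points \<open>i\<close> and \<open>j\<close> lie weakly on the same side of
    the line \<open>b u\<close>. Its other side cuts off a proper part of \<open>C i j\<close>, as
    \<open>b\<close> is missing, so by minimality it is empty.\<close>
  have supp: "(\<forall>p\<in>P. orient b u p \<le> 0) \<or> (\<forall>p\<in>P. orient u b p \<le> 0)"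
    if Q: "Q \<in> \<K>" "Q \<noteq> K" "b \<in> touched P Q" "u \<in> touched P Q" "orient i j b > 0" for Q b u
  proof -
    have bP: "b \<in> P" "u \<in> P" using Q T by auto
    have u: "orient i j u \<ge> 0" using not_right Q by blast
    have line: "orient i j ((1 - s) *\<^sub>R b + s *\<^sub>R u) > 0" if "0 < s" "s < 1" for s
      using that u Q(5) by (simp add: orient_combination add_pos_nonneg)
    have "\<not> (orient b u i > 0 \<and> orient b u j < 0)"
    proof
      assume "orient b u i > 0 \<and> orient b u j < 0"
      then obtain s t where "0 < s" "s < 1" "0 < t" "t < 1" "(1 - s) *\<^sub>R b + s *\<^sub>R u = (1 - t) *\<^sub>R i + t *\<^sub>R j"
        using convex_position_crossing[OF P(2), of b u i j] bP iP by auto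
      then show False using line[of s] orient_combination[of "1 - t" t i j i j] by simp
    qed
    moreover have "\<not> (orient b u j > 0 \<and> orient b u i < 0)"
    proof
      assume "orient b u j > 0 \<and> orient b u i < 0"
      then obtain s t where "0 < s" "s < 1" "0 < t" "t < 1" "(1 - s) *\<^sub>R b + s *\<^sub>R u = (1 - t) *\<^sub>R j + t *\<^sub>R i"
        using convex_position_crossing[OF P(2), of b u j i] bP iP by auto
      then show False using line[of s] orient_combination[of "1 - t" t i j j i] by simp
    qed
    ultimately have "orient b u i \<le> 0 \<and> orient b u j \<le> 0 \<or> orient u b i \<le> 0 \<and> orient u b j \<le> 0"
      using orient_swap[of u b i] orient_swap[of u b j] by linarith
    then obtain x y where xy: "(x = b \<and> y = u) \<or> (x = u \<and> y = b)" "orient x y i \<le> 0" "orient x y j \<le> 0"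
      by blast
    have xyb: "orient x y b = 0" using xy(1) by auto
    have "C x y \<subset> C i j"
    proof
      show "C x y \<subseteq> C i j"
      proof
        fix p assume p: "p \<in> C x y"
        have pP: "p \<in> P" "orient x y p > 0" using p by (auto simp: C_def)
        then have "orient i j p \<noteq> 0"
          using xy \<open>i \<noteq> j\<close> iP by (intro convex_position_orient[OF P(2)]) auto
        moreover have "\<not> orient i j p < 0"
        proof
          assume "orient i j p < 0"
          then obtain s t where st: "0 < s" "s < 1" "0 < t" "t < 1"
            "(1 - s) *\<^sub>R i + s *\<^sub>R j = (1 - t) *\<^sub>R b + t *\<^sub>R p"
            using convex_position_crossing[OF P(2), of i j b p] bP iP pP Q(5) by auto
          have "orient x y ((1 - s) *\<^sub>R i + s *\<^sub>R j) \<le> 0"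
            using mult_nonneg_nonpos[of "1 - s" "orient x y i"] mult_nonneg_nonpos[of s "orient x y j"] xy(2,3) st(1,2)
            by (simp add: orient_combination)
          moreover have "orient x y ((1 - t) *\<^sub>R b + t *\<^sub>R p) > 0"
            using xyb pP st(3) by (simp add: orient_combination)
          ultimately show False using st(5) by simp
        qed
        ultimately show "p \<in> C i j" using pP by (simp add: C_def)
      qed
      show "C x y \<noteq> C i j" using xyb Q(5) bP unfolding C_def by force
    qed
    then have "card (C x y) < card (C i j)" using P(1) by (intro psubset_card_mono) (auto simp: C_def)
    then have "C x y = {}" using least[OF Q(1)] xy(1) Q(3,4) by blast
    then have "\<forall>p\<in>P. orient x y p \<le> 0" unfolding C_def by force
    then show ?thesis using xy(1) by blast
  qed
  have eq: "touched P Q = {b, i, j}" if Q: "Q \<in> \<K>" "Q \<noteq> K" "b \<in> touched P Q" "orient i j b > 0" for Q b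
  proof -
    have "u \<in> {i, j}" if u: "u \<in> touched P Q" "u \<noteq> b" for u
    proof (rule ccontr)
      assume uij: "u \<notin> {i, j}"
      then have "orient i j u \<noteq> 0"
        using u T iP \<open>i \<noteq> j\<close> by (intro convex_position_orient[OF P(2)]) auto
      then have upos: "orient i j u > 0" using not_right[OF Q(1,2,3) u(1) Q(4)] by simp
      obtain w where w: "w \<in> touched P Q" "w \<noteq> b" "w \<noteq> u" using third[OF Q(1)] by blast
      have "P = {b, u, w}"
      proof (rule supporting_triangle[OF P(2)])
        show "{b, u, w} \<subseteq> P" using Q u w T by auto
        show "distinct [b, u, w]" using u w by auto
        fix x y assume xy: "{x, y} \<subseteq> {b, u, w}"
        show "(\<forall>p\<in>P. orient x y p \<le> 0) \<or> (\<forall>p\<in>P. orient y x p \<le> 0)"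
        proof (cases "x = y")
          case False
          \<comment> \<open>Each side of the triangle has \<open>b\<close> or \<open>u\<close> as an
            end, and both lie strictly left of \<open>i j\<close>; so \<open>supp\<close> applies
            wherever \<open>w\<close> lies.\<close>
          then have "x \<in> {b, u} \<and> y \<in> {b, u, w} \<or> y \<in> {b, u} \<and> x \<in> {b, u, w}" using xy by auto
          then show ?thesis
            using supp[OF Q(1,2), of x y] supp[OF Q(1,2), of y x] Q(3,4) u w upos by auto
        qed simp
      qed
      then have "card P \<le> 3" by (simp add: card_insert_if)
      then show False using P(3) by simp
    qed
    then have sub: "touched P Q \<subseteq> {b, i, j}" by blast
    have "card {b, i, j} \<le> 3" by (simp add: card_insert_if)
    then have "card {b, i, j} \<le> card (touched P Q)" using three[OF Q(1)] by simp
    then show ?thesis using card_seteq[OF _ sub] by simp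
  qed
  obtain b where b: "b \<in> P" "orient i j b > 0" using ne by (auto simp: C_def)
  obtain M N where MN: "M \<in> \<K>" "N \<in> \<K>" "M \<noteq> N" "b \<in> touched P M" "b \<in> touched P N"
    using two[OF b(1)] b(1) unfolding touched_def by blast
  have all: "{i, j, b} \<subseteq> touched P Q" if "Q \<in> \<K>" "b \<in> touched P Q" for Q
    using eq[OF that(1) _ that(2) b(2)] ij that(2) by (cases "Q = K") auto
  have "M \<inter> N \<inter> convex hull {i, j, b} \<noteq> {}"
    using common_triangle_meets[of M N i j b] cvx MN all[of M] all[of N] b(2) by (auto simp: touched_def)
  moreover have "convex hull {i, j, b} \<subseteq> convex hull P" using iP b by (intro hull_mono) auto
  ultimately show False using disj[OF MN(1,2,3)] by blast
qed

section \<open>Deleting sets, and the cases of two and five points\<close>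

definition convex_encapsulation :: "(real^2) set set \<Rightarrow> (real^2) set \<Rightarrow> bool" where
  "convex_encapsulation \<K> P \<longleftrightarrow> finite \<K> \<and> (\<forall>K\<in>\<K>. convex K) \<and> encapsulates \<K> P"

lemma convex_encapsulation_remove:
  assumes "convex_encapsulation \<K> P" "Q \<subseteq> P" "\<F> \<subseteq> \<K>" "\<And>K. K \<in> \<F> \<Longrightarrow> touched P K \<inter> Q = {}"
  shows "convex_encapsulation (\<K> - \<F>) Q"
proof -
  have "encapsulates_point (\<K> - \<F>) p" if "p \<in> Q" for p
    using assms that unfolding convex_encapsulation_def encapsulates_def touched_def
    by (intro encapsulates_point_remove) (auto intro: finite_subset)
  then show ?thesis using assms(1) by (auto simp: convex_encapsulation_def encapsulates_def)
qed

text \<open>On the line through \<open>a\<close> and \<open>b\<close> take a point before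
  \<open>a\<close>, one between \<open>a\<close> and \<open>b\<close>, and one after
  \<open>b\<close>. Any two have \<open>a\<close> or \<open>b\<close> between them, so they lie in
  three different sets.\<close>

lemma convex_encapsulation_two_points:
  assumes enc: "convex_encapsulation \<K> {a, b}" and "a \<noteq> b"
  shows "card \<K> \<ge> 3"
proof -
  have fin: "finite \<K>" and cvx: "\<And>K. K \<in> \<K> \<Longrightarrow> convex K"
    and pt: "encapsulates_point \<K> a" "encapsulates_point \<K> b"
    using enc by (auto simp: convex_encapsulation_def encapsulates_def)
  \<comment> \<open>Pushing \<open>a\<close> away from \<open>a - d\<close> or \<open>a + d\<close>
    moves it along the line by \<open>e\<close> times \<open>d\<close> or its negative, so
    \<open>push\<close> provides the three points; \<open>e < 1\<close> keeps the middle one before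
    \<open>b\<close>.\<close>
  define d where "d = b - a"
  have "a + d \<noteq> a" "a - d \<noteq> a" "b - d \<noteq> b" using assms(2) by (auto simp: d_def)
  then have "\<forall>\<^sub>F e in at_right 0. e < (1::real) \<and> e > 0 \<and> push (a - d) e a \<in> \<Union>\<K> \<and>
      push (a + d) e a \<in> \<Union>\<K> \<and> push (b - d) e b \<in> \<Union>\<K>"
    using eventually_at_right_real[of 0 "1::real"]
    by (intro eventually_conj encapsulates_point_push pt) (auto elim: eventually_mono)
  then obtain e where e: "0 < e" "e < 1" "push (a - d) e a \<in> \<Union>\<K>" "push (a + d) e a \<in> \<Union>\<K>"
      "push (b - d) e b \<in> \<Union>\<K>"
    using eventually_happens[of _ "at_right (0::real)"] trivial_limit_at_right_real by blast
  have "push (a - d) e a = a + e *\<^sub>R d" "push (a + d) e a = a - e *\<^sub>R d" "push (b - d) e b = b + e *\<^sub>R d"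
    by (simp_all add: push_def)
  then obtain K L M where KLM: "K \<in> \<K>" "L \<in> \<K>" "M \<in> \<K>" "a + e *\<^sub>R d \<in> K" "a - e *\<^sub>R d \<in> L" "b + e *\<^sub>R d \<in> M"
    using e by auto
  have between: False if "s > 0" "t > 0" "p + s *\<^sub>R d \<in> N" "p - t *\<^sub>R d \<in> N" "N \<in> \<K>" "p \<in> {a, b}" for s t p N
  proof -
    have "(t / (s + t)) *\<^sub>R (p + s *\<^sub>R d) + (s / (s + t)) *\<^sub>R (p - t *\<^sub>R d) \<in> N"
      using that cvx[OF that(5)] by (intro convexD) (auto simp: add_divide_distrib[symmetric] add.commute)
    moreover have "(t / (s + t)) *\<^sub>R (p + s *\<^sub>R d) + (s / (s + t)) *\<^sub>R (p - t *\<^sub>R d) = (t / (s + t) + s / (s + t)) *\<^sub>R p"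
      by (simp add: algebra_simps)
    moreover have "t / (s + t) + s / (s + t) = 1"
      using that by (simp add: add_divide_distrib[symmetric] add.commute)
    ultimately have "p \<in> N" by simp
    then show False using encapsulates_point_not_mem pt that by blast
  qed
  have "K \<noteq> L" using between[of e e a K] KLM e by auto
  moreover have "a + (1 + e) *\<^sub>R d = b + e *\<^sub>R d" "b - (1 - e) *\<^sub>R d = a + e *\<^sub>R d"
    by (simp_all add: d_def algebra_simps)
  then have "L \<noteq> M" "K \<noteq> M" using between[of "1 + e" e a L] between[of e "1 - e" b K] KLM e by auto
  ultimately have "card {K, L, M} = 3" by simp
  moreover have "card {K, L, M} \<le> card \<K>" using KLM fin by (intro card_mono) auto
  ultimately show ?thesis by simp
qed

text \<open>With four sets, deleting sets together with the points they touch shows that any two sets touch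
  at least four points between them. Of the three ways to join four points of \<open>P\<close> by two segments,
  one crosses, and segments spanned by different sets never do; this rules out every incidence pattern.\<close>

lemma convex_encapsulation_five_points:
  assumes P: "card P = 5" "convex_position P" and enc: "convex_encapsulation \<K> P"
    and disj: "\<And>K L. K \<in> \<K> \<Longrightarrow> L \<in> \<K> \<Longrightarrow> K \<noteq> L \<Longrightarrow> K \<inter> L \<inter> convex hull P = {}"
    and four: "\<And>Q \<F>. Q \<subseteq> P \<Longrightarrow> card Q = 4 \<Longrightarrow> convex_encapsulation \<F> Q \<Longrightarrow> card \<F> \<ge> 4"
  shows "card \<K> \<ge> 5"
proof (rule ccontr)
  assume "\<not> ?thesis"
  then have le: "card \<K> \<le> 4" by simp
  have fin: "finite \<K>" "finite P" and cvx: "\<And>K. K \<in> \<K> \<Longrightarrow> convex K"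
    and pt: "\<And>p. p \<in> P \<Longrightarrow> encapsulates_point \<K> p"
    using enc P by (auto simp: convex_encapsulation_def encapsulates_def intro: card_ge_0_finite)
  define T where "T = touched P"
  have T: "T K \<subseteq> P" "finite (T K)" for K using fin by (auto simp: T_def touched_def)
  have two: "\<exists>K\<in>\<K>. \<exists>L\<in>\<K>. K \<noteq> L \<and> p \<in> closure K \<and> p \<in> closure L" if "p \<in> P" for p
    using cvx by (intro encapsulates_point_two_sets[OF pt[OF that] fin(1)]) simp
  have two': "\<exists>K\<in>\<K>. K \<noteq> M \<and> p \<in> T K" if "p \<in> P" for p M
  proof -
    from two[OF that] obtain K L where KL: "K \<in> \<K>" "L \<in> \<K>" "K \<noteq> L" "p \<in> closure K" "p \<in> closure L"
      by blast
    then have "p \<in> T K" "p \<in> T L" using that by (simp_all add: T_def touched_def)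
    then show ?thesis using KL(1-3) by (cases "K = M") blast+
  qed
  \<comment> \<open>Dropping a set that touches at most one point would leave at most three sets for
    four points.\<close>
  have T2: "card (T K) \<ge> 2" if K: "K \<in> \<K>" for K
  proof (rule ccontr)
    assume "\<not> ?thesis"
    then have "card (P - T K) \<ge> 4" using P(1) T by (simp add: card_Diff_subset)
    then obtain Q where Q: "Q \<subseteq> P - T K" "card Q = 4" using obtain_subset_with_card_n by metis
    then have "card (\<K> - {K}) \<ge> 4"
      using K by (intro four[of Q] convex_encapsulation_remove[OF enc]) (auto simp: T_def)
    then show False using K le fin by simp
  qed
  \<comment> \<open>Dropping two sets that touch at most three points would leave at most two sets
    for two points.\<close>
  have T4: "card (T K \<union> T L) \<ge> 4" if KL: "K \<in> \<K>" "L \<in> \<K>" "K \<noteq> L" for K L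
  proof (rule ccontr)
    assume "\<not> ?thesis"
    then have "card (P - (T K \<union> T L)) \<ge> 2" using P(1) T by (subst card_Diff_subset) auto
    then obtain Q where Q: "Q \<subseteq> P - (T K \<union> T L)" "card Q = 2" using obtain_subset_with_card_n by metis
    then obtain a b where ab: "Q = {a, b}" "a \<noteq> b" by (auto simp: card_2_iff)
    have "convex_encapsulation (\<K> - {K, L}) {a, b}"
      using Q ab KL by (intro convex_encapsulation_remove[OF enc]) (auto simp: T_def)
    from convex_encapsulation_two_points[OF this ab(2)] show False
      using KL le fin by (simp add: card_Diff_subset)
  qed
  obtain Q4 where "Q4 \<subseteq> P" "card Q4 = 4" using obtain_subset_with_card_n[of 4 P] P(1) by auto
  then have "card \<K> \<ge> 4"
    using four[of Q4 \<K>] enc by (auto simp: convex_encapsulation_def encapsulates_def)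
  then have card\<K>: "card \<K> = 4" using le by simp
  define X where "X p q r s \<longleftrightarrow> orient p q r * orient p q s < 0" for p q r s
  have nc: "\<not> X p q r s" if "M \<in> \<K>" "N \<in> \<K>" "M \<noteq> N" "p \<in> T M" "q \<in> T M" "r \<in> T N" "s \<in> T N" for M N p q r s
    using touched_not_crossing[OF P(2) cvx[OF that(1)] cvx[OF that(2)] disj[OF that(1,2,3)], of p q r s]
      touched_not_crossing[OF P(2) cvx[OF that(1)] cvx[OF that(2)] disj[OF that(1,2,3)], of p q s r]
      that unfolding X_def T_def mult_less_0_iff by auto
  \<comment> \<open>With A, B, C for \<open>orient p q r\<close>, \<open>orient p q s\<close>,
    \<open>orient p r s\<close>, the alternatives read AB < 0, AC > 0, BC < 0. If all failed, A and
    B as well as B and C would agree in sign, but A and C would not.\<close>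
  have pairing: "X p q r s \<or> X p r q s \<or> X p s q r" if "{p, q, r, s} \<subseteq> P" "distinct [p, q, r, s]" for p q r s
  proof -
    have "orient p q r \<noteq> 0" "orient p q s \<noteq> 0" "orient p r s \<noteq> 0"
      using that by (intro convex_position_orient[OF P(2)]; auto)+
    then show ?thesis
      unfolding X_def mult_less_0_iff orient_swap_right[of p r q] orient_swap_right[of p s q] orient_swap_right[of p s r]
      by linarith
  qed
  have tt: False if "M \<in> \<K>" "N \<in> \<K>" "M \<noteq> N" "{p, q, r} \<subseteq> T M" "{p, q, r} \<subseteq> T N" "distinct [p, q, r]" for M N p q r
  proof -
    have "orient p q r \<noteq> 0" using that T by (intro convex_position_orient[OF P(2)]) auto
    then have "M \<inter> N \<inter> convex hull {p, q, r} \<noteq> {}"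
      using that cvx by (intro common_triangle_meets) (auto simp: T_def touched_def)
    moreover have "convex hull {p, q, r} \<subseteq> convex hull P" using that T by (intro hull_mono) auto
    ultimately show False using disj[OF that(1,2,3)] by blast
  qed
  obtain Q where Q: "Q \<in> \<K>" "card (T Q) \<le> 2"
    using ex_touched_le_2[OF fin(2) P(2) _ cvx disj two] P(1) by (auto simp: T_def)
  then have "card (T Q) = 2" using T2 by (meson le_antisym)
  then obtain b w where bw: "T Q = {b, w}" "b \<noteq> w" by (auto simp: card_2_iff)
  have "card (P - {b, w}) = 3" using bw T[of Q] P(1) by (subst card_Diff_subset) auto
  then obtain x y z where xyz: "P - {b, w} = {x, y, z}" "distinct [x, y, z]" by (auto simp: card_3_iff)
  then have Peq: "P = {b, w, x, y, z}" and dist: "distinct [b, w, x, y, z]" using bw T[of Q] by auto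
  \<comment> \<open>A set missing two of \<open>x\<close>, \<open>y\<close>, \<open>z\<close>
    touches together with \<open>Q\<close> at most three points, against \<open>T4\<close>.\<close>
  have at2: "u \<in> T M \<or> v \<in> T M" if M: "M \<in> \<K>" "M \<noteq> Q" and uv: "u \<in> {x, y, z}" "v \<in> {x, y, z}" "u \<noteq> v" for M u v
  proof (rule ccontr)
    assume no: "\<not> ?thesis"
    have "T M \<union> T Q \<subseteq> P - {u, v}" using no T[of M] T[of Q] bw uv dist by auto
    then have "card (T M \<union> T Q) \<le> card (P - {u, v})" using fin by (intro card_mono) auto
    also have "\<dots> = 3" using uv Peq P(1) by (subst card_Diff_subset) auto
    finally show False using T4[OF M(1) Q(1) M(2)] by simp
  qed
  have others: "\<exists>R S. \<K> = {M, N, R, S} \<and> distinct [M, N, R, S]" if "M \<in> \<K>" "N \<in> \<K>" "M \<noteq> N" for M N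
  proof -
    have "card (\<K> - {M, N}) = 2" using that fin card\<K> by (simp add: card_Diff_subset)
    then obtain R S where RS: "\<K> - {M, N} = {R, S}" "R \<noteq> S" by (auto simp: card_2_iff)
    then have "M \<noteq> R" "N \<noteq> R" "M \<noteq> S" "N \<noteq> S" by blast+
    moreover have "\<K> = {M, N, R, S}" using RS(1) that(1,2) by blast
    ultimately have "\<K> = {M, N, R, S} \<and> distinct [M, N, R, S]" using that(3) RS(2) by auto
    then show ?thesis by blast
  qed
  show False
  proof (cases "\<exists>K\<in>\<K>. K \<noteq> Q \<and> b \<in> T K \<and> w \<in> T K")
    case True
    then obtain K where K: "K \<in> \<K>" "K \<noteq> Q" "b \<in> T K" "w \<in> T K" by blast
    obtain R S where RS: "\<K> = {Q, K, R, S}" "distinct [Q, K, R, S]" using others[OF Q(1) K(1)] K(2) by auto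
    have un: "card (T R \<union> T S) \<ge> 4" using RS T4[of R S] by auto
    show False
    proof (cases "T K = P")
      case True
      \<comment> \<open>By \<open>at2\<close> the set \<open>M\<close> shares two of
        \<open>x\<close>, \<open>y\<close>, \<open>z\<close> with \<open>K\<close>; a further
        \<open>b\<close> or \<open>w\<close> would complete a common triangle.\<close>
      have small: "T M \<subseteq> {x, y, z}" if M: "M \<in> {R, S}" for M
      proof
        fix p assume p: "p \<in> T M"
        have MK: "M \<in> \<K>" "M \<noteq> K" "M \<noteq> Q" using M RS by auto
        show "p \<in> {x, y, z}"
        proof (rule ccontr)
          assume p': "p \<notin> {x, y, z}"
          obtain u v where "u \<in> T M" "v \<in> T M" "u \<in> {x, y, z}" "v \<in> {x, y, z}" "u \<noteq> v"
            using at2[OF MK(1,3), of x y] at2[OF MK(1,3), of y z] at2[OF MK(1,3), of x z] dist by auto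
          then show False using tt[OF MK(1) K(1) MK(2), of p u v] p p' T[of M] True by auto
        qed
      qed
      then have "card (T R \<union> T S) \<le> card {x, y, z}" by (intro card_mono) auto
      then show False using un by (simp add: card_insert_if split: if_splits)
    next
      case False
      then obtain h where h: "h \<in> P" "h \<notin> T K" using T[of K] by blast
      have hQ: "h \<notin> T Q" using h K bw by auto
      have TK: "T K = P - {h}"
        using T[of K] h K at2[OF K(1,2), of h] Peq by auto
      have RSK: "R \<in> \<K>" "S \<in> \<K>" "R \<noteq> K" "S \<noteq> K" using RS by auto
      have hRS: "h \<in> T R" "h \<in> T S" using two'[OF h(1), of R] two'[OF h(1), of S] RS h hQ by auto
      then have "card (T R \<union> T S - {h}) \<ge> 3" using un T by (simp add: card_Diff_singleton)
      then obtain E where "E \<subseteq> T R \<union> T S - {h}" "card E = 3" using obtain_subset_with_card_n by metis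
      then obtain p q r where pqr: "{p, q, r} \<subseteq> T R \<union> T S - {h}" "distinct [p, q, r]" by (auto simp: card_3_iff)
      have inK: "{p, q, r} \<subseteq> T K" using TK pqr(1) T(1)[of R] T(1)[of S] by blast
      \<comment> \<open>Every pairing joins \<open>h\<close> to a point by a segment of
        \<open>R\<close> or \<open>S\<close>, and the other two points by a segment of
        \<open>K\<close>.\<close>
      have "\<not> X h u v v'" if "u \<in> {p, q, r}" "v \<in> {p, q, r}" "v' \<in> {p, q, r}" for u v v'
      proof -
        have "u \<in> T R \<or> u \<in> T S" "v \<in> T K" "v' \<in> T K" using that pqr(1) inK by blast+
        then show ?thesis using nc[OF RSK(1) K(1) RSK(3) hRS(1)] nc[OF RSK(2) K(1) RSK(4) hRS(2)] by blast
      qed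
      then have "\<not> X h p q r" "\<not> X h q p r" "\<not> X h r p q" by simp_all
      moreover have "{h, p, q, r} \<subseteq> P" "distinct [h, p, q, r]"
        using h inK T(1)[of K] pqr(2) by auto
      ultimately show False using pairing by blast
    qed
  next
    case False
    obtain K where K: "K \<in> \<K>" "K \<noteq> Q" "b \<in> T K" using two'[of b Q] Peq by blast
    obtain R where R: "R \<in> \<K>" "R \<noteq> Q" "w \<in> T R" using two'[of w Q] Peq by blast
    have "w \<notin> T K" "b \<notin> T R" using False K R by auto
    then have QK: "Q \<in> \<K>" "K \<in> \<K>" "Q \<noteq> K" and QR: "Q \<in> \<K>" "R \<in> \<K>" "Q \<noteq> R"
      and KR: "K \<in> \<K>" "R \<in> \<K>" "K \<noteq> R" using K R Q(1) by auto
    have bwQ: "b \<in> T Q" "w \<in> T Q" using bw by auto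
    \<comment> \<open>The pairing with segment \<open>b w\<close> belongs to \<open>Q\<close> and
      \<open>K\<close>, the other two to \<open>K\<close> and \<open>R\<close>; so none of the three
      crosses.\<close>
    have no_pair: False if "p \<in> {x, y, z}" "q \<in> {x, y, z}" "p \<noteq> q" "p \<in> T K" "q \<in> T K" "p \<in> T R" "q \<in> T R" for p q
    proof -
      have "{b, w, p, q} \<subseteq> P" "distinct [b, w, p, q]" using that(1-3) Peq dist by auto
      moreover have "\<not> X b w p q" using nc[OF QK bwQ] that by blast
      moreover have "\<not> X b p w q" "\<not> X b q w p" using nc[OF KR K(3) _ R(3)] that by blast+
      ultimately show False using pairing by blast
    qed
    \<comment> \<open>The remaining pattern: \<open>K\<close> and \<open>R\<close> share only
      \<open>p\<close> among \<open>x\<close>, \<open>y\<close>, \<open>z\<close>. Since every point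
      is touched twice, the fourth set \<open>S\<close> touches \<open>q\<close> and
      \<open>r\<close>.\<close>
    have final: False
      if pqr: "{x, y, z} = {p, q, r}" "distinct [p, q, r]" "p \<in> T K" "q \<in> T K" "p \<in> T R" "r \<in> T R" "q \<notin> T R" "r \<notin> T K" for p q r
    proof -
      obtain U V where UV: "\<K> = {Q, K, U, V}" "distinct [Q, K, U, V]" using others[OF QK] by blast
      define S where "S = (if R = U then V else U)"
      have "R \<in> {Q, K, U, V}" using KR(2) unfolding UV(1) .
      then have "R = U \<or> R = V" using KR(3) QR(3) by blast
      then have \<K>: "\<K> = {Q, K, R, S}" unfolding UV(1) S_def by (cases "R = U") (simp_all, blast)
      have QS: "Q \<in> \<K>" "S \<in> \<K>" "Q \<noteq> S" and KS: "K \<in> \<K>" "S \<in> \<K>" "K \<noteq> S"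
        using UV(2) unfolding \<K> by (auto simp: S_def)
      have PP: "{b, w, p, q, r} \<subseteq> P" "distinct [b, w, p, q, r]" using pqr(1,2) Peq dist by auto
      have "q \<notin> T Q" "r \<notin> T Q" using bw PP(2) by auto
      moreover obtain M where "M \<in> \<K>" "M \<noteq> K" "q \<in> T M" using two'[of q K] PP(1) by auto
      moreover obtain N where "N \<in> \<K>" "N \<noteq> R" "r \<in> T N" using two'[of r R] PP(1) by auto
      ultimately have qr: "q \<in> T S" "r \<in> T S" unfolding \<K> using pqr(7,8) by blast+
      have "\<not> X b w p r" using nc[OF QR bwQ] pqr by blast
      moreover have "\<not> X b p w r" using nc[OF KR K(3) _ R(3)] pqr by blast
      ultimately have 1: "X b r w p" using pairing[of b w p r] PP by auto
      have "\<not> X b w q r" using nc[OF QS bwQ] qr by blast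
      moreover have "\<not> X b q w r" using nc[OF KR K(3) _ R(3)] pqr by blast
      ultimately have 2: "X b r w q" using pairing[of b w q r] PP by auto
      have "\<not> X b p q r" using nc[OF KS K(3)] qr pqr by blast
      moreover have "\<not> X b q p r" using nc[OF KR K(3)] pqr by blast
      ultimately have 3: "X b r p q" using pairing[of b p q r] PP by auto
      \<comment> \<open>The line \<open>b r\<close> would separate each two of the three points
        \<open>w\<close>, \<open>p\<close>, \<open>q\<close>.\<close>
      show False using 1 2 3 unfolding X_def mult_less_0_iff by linarith
    qed
    have two_of: "(x \<in> T M \<or> y \<in> T M) \<and> (y \<in> T M \<or> z \<in> T M) \<and> (x \<in> T M \<or> z \<in> T M)" if "M \<in> {K, R}" for M
      using at2[of M x y] at2[of M y z] at2[of M x z] that K R dist by auto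
    show False
      using two_of[of K] two_of[of R] no_pair[of x y] no_pair[of y z] no_pair[of x z] dist
        final[of x y z] final[of x z y] final[of y x z] final[of y z x] final[of z x y] final[of z y x]
      by (simp add: insert_commute) blast
  qed
qed

section \<open>The induction and the bound\<close>

lemma convex_encapsulation_card:
  assumes "convex_encapsulation \<K> P" "convex_position P" "card P = n" "n \<ge> 1"
  shows "card \<K> \<ge> (n + 5) div 2 - \<delta> n"
  using assms
proof (induction n arbitrary: \<K> P rule: less_induct)
  case (less n)
  have fin: "finite \<K>" "finite P" and cvx: "\<And>K. K \<in> \<K> \<Longrightarrow> convex K" and enc: "encapsulates \<K> P"
    using less.prems by (auto simp: convex_encapsulation_def intro: card_ge_0_finite)
  have two: "\<exists>K\<in>\<K>. \<exists>L\<in>\<K>. K \<noteq> L \<and> p \<in> closure K \<and> p \<in> closure L" if "p \<in> P" for p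
    using encapsulates_point_two_sets[of \<K> p] enc fin cvx that by (auto simp: encapsulates_def)
  have drop2: "card (\<K> - {K}) \<ge> (n - 2 + 5) div 2 - \<delta> (n - 2)"
    if "K \<in> \<K>" "n \<ge> 3" "card (touched P K) \<le> 2" for K
  proof -
    have "touched P K \<subseteq> P" by (auto simp: touched_def)
    then have "card (P - touched P K) \<ge> n - 2"
      using fin that(3) less.prems(3) by (subst card_Diff_subset) (auto intro: finite_subset)
    then obtain Q where Q: "Q \<subseteq> P - touched P K" "card Q = n - 2" using obtain_subset_with_card_n by metis
    have "convex_encapsulation (\<K> - {K}) Q"
      using Q that(1) by (intro convex_encapsulation_remove[OF less.prems(1)]) auto
    moreover have "convex_position Q" using Q less.prems(2) convex_position_subset by blast
    ultimately show ?thesis using that(2) Q by (intro less.IH) auto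
  qed
  consider "n = 1" | "n = 2" | "n = 3" | "n \<ge> 4" using less.prems(4) by linarith
  then show ?case
  proof cases
    case 1
    then obtain p where "p \<in> P" using less.prems(3) by (auto simp: card_1_singleton_iff)
    then obtain K L where KL: "K \<in> \<K>" "L \<in> \<K>" "K \<noteq> L" using two by blast
    then have "card {K, L} \<le> card \<K>" using fin by (intro card_mono) auto
    then show ?thesis using KL 1 by (simp add: \<delta>_def)
  next
    case 2
    then obtain a b where "P = {a, b}" "a \<noteq> b" using less.prems(3) by (auto simp: card_2_iff)
    then show ?thesis using convex_encapsulation_two_points less.prems(1) 2 by (simp add: \<delta>_def)
  next
    case 3
    then have "2 \<le> card P" using less.prems(3) by simp
    then obtain Q where Q: "Q \<subseteq> P" "card Q = 2" using obtain_subset_with_card_n by metis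
    then obtain a b where ab: "Q = {a, b}" "a \<noteq> b" by (auto simp: card_2_iff)
    have "convex_encapsulation \<K> Q" using less.prems(1) Q by (auto simp: convex_encapsulation_def encapsulates_def)
    then have "card \<K> \<ge> 3" using convex_encapsulation_two_points ab by blast
    then show ?thesis using 3 by (simp add: \<delta>_def)
  next
    case 4
    then have \<delta>: "\<delta> n = 0" by (simp add: \<delta>_def)
    show ?thesis
    proof (cases "\<exists>K\<in>\<K>. \<exists>L\<in>\<K>. K \<noteq> L \<and> K \<inter> L \<inter> convex hull P \<noteq> {}")
      case True
      then obtain K L c where "K \<in> \<K>" "L \<in> \<K>" "K \<noteq> L" "c \<in> K" "c \<in> L" "c \<in> convex hull P" by blast
      \<comment> \<open>For integers this says that there are at least ceil(n/2) + 2 sets, which is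
        the bound.\<close>
      then have "n \<le> 2 * (card \<K> - 2)"
        using card_le_of_common_point[of P \<K>] fin cvx enc less.prems by blast
      then show ?thesis using 4 \<delta> by linarith
    next
      case False
      then have disj: "K \<inter> L \<inter> convex hull P = {}" if "K \<in> \<K>" "L \<in> \<K>" "K \<noteq> L" for K L using that by blast
      show ?thesis
      proof (cases "n = 5")
        case True
        have "card \<F> \<ge> 4" if "Q \<subseteq> P" "card Q = 4" "convex_encapsulation \<F> Q" for Q \<F>
          using less.IH[of 4 \<F> Q] that True convex_position_subset[OF less.prems(2) that(1)] by (simp add: \<delta>_def)
        then have "card \<K> \<ge> 5"
          using convex_encapsulation_five_points[of P \<K>] less.prems True disj by blast
        then show ?thesis using True by simp
      next
        case False
        obtain Q where Q: "Q \<in> \<K>" "card (touched P Q) \<le> 2"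
          using ex_touched_le_2[OF fin(2) less.prems(2) _ cvx disj two] 4 less.prems(3) by blast
        have "card (\<K> - {Q}) \<ge> (n - 2 + 5) div 2 - \<delta> (n - 2)"
          using Q 4 by (intro drop2) auto
        \<comment> \<open>For \<open>n \<ge> 4\<close> the exception could only enter through n = 5,
          which is settled above.\<close>
        moreover have "\<delta> (n - 2) = 0" using 4 False by (auto simp: \<delta>_def)
        moreover have "card \<K> > 0" using Q fin by (auto simp: card_gt_0_iff)
        moreover have "(n - 2 + 5) div 2 + 1 = (n + 5) div 2" using 4 by linarith
        ultimately show ?thesis using Q fin by simp
      qed
    qed
  qed
qed

text \<open>The disjunct \<open>infinite\<close> is there because \<open>card\<close> is 0 on
  infinite families. For the maximum any set of \<open>n\<close> points in convex position serves as
  a witness, as the bound holds for all of them.\<close>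

theorem theorem2:
  fixes n :: nat
  assumes "n \<ge> 1"
  shows "(\<forall>(P :: (real^2) set) (\<K> :: (real^2) set set).
            card P = n \<and> convex_position P \<and> (\<forall>C\<in>\<K>. convex C) \<and> encapsulates \<K> P \<longrightarrow>
              infinite \<K> \<or> card \<K> \<ge> (n + 5) div 2 - \<delta> n)
         \<and> enc_convex n \<ge> (n + 5) div 2 - \<delta> n"
proof -
  have bound: "card \<K> \<ge> (n + 5) div 2 - \<delta> n"
    if "card P = n" "convex_position P" "\<forall>C\<in>\<K>. convex C" "encapsulates \<K> P" "finite \<K>"
    for P and \<K> :: "(real^2) set set"
    using convex_encapsulation_card[of \<K> P n] that assms by (simp add: convex_encapsulation_def)
  obtain P where P: "finite P" "card P = n" "convex_position P" using ex_convex_position by blast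
  obtain \<K> where \<K>: "finite \<K>" "card \<K> = convex_enc_number P" "\<forall>C\<in>\<K>. convex C" "encapsulates \<K> P"
    using convex_enc_number_attained[OF P(1)] by blast
  have "(n + 5) div 2 - \<delta> n \<le> convex_enc_number P"
    using bound[OF P(2,3) \<K>(3,4,1)] \<K>(2) by simp
  also have "\<dots> \<le> enc_convex n"
    unfolding enc_convex_def using enc_convex_Max_wf(1)[OF assms] P by (intro Max_ge) auto
  finally show ?thesis using bound by blast
qed

end
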